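(* For any block-stable class $\mathcal{A}$ of graphs there exist constants $c_1,c_2>0$ such that for any $t>1$ and any $n$ with $\mathcal{A}_n\ne\emptyset$, for $\mathrm{G}_n$ a uniformly random element of $\mathcal{A}_n$, $$\mathbf{P}\left(\operatorname{Diam}(\mathrm{G}_n)\ge t n^{1/2}\right)<c_1\exp(-c_2t^2).$$
   Context: Graphs are finite and simple, and classes of graphs are closed under isomorphism. A bridge in a graph is an edge whose deletion increases the number of connected components. A block in a graph is either a maximal $2$-connected subgraph or the subgraph formed by a bridge or an isolated vertex. A class $\mathcal{A}$ of graphs is block-stable when a graph $G$ is in $\mathcal{A}$ if and only if each block of $G$ is in $\mathcal{A}$. The block-diameter $\operatorname{Diam}(G)$ of a (possibly disconnected) graph is the greatest number of blocks that any path in $G$ passes through (a path passes through a block if it uses an edge of it; a single-vertex path at an isolated vertex passes through that block). $\mathcal{A}_n$ is the set of graphs in $\mathcal{A}$ with vertex set $[n]=\{1,\dots,n\}$. The constants $c_1,c_2$ may depend on $\mathcal{A}$. *)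

theory Defs
  imports "HOL-Probability.Probability"
begin

type_synonym 'v graph = "'v set \<times> 'v set set"

abbreviation verts :: "'v graph \<Rightarrow> 'v set" where
  "verts G \<equiv> fst G"

abbreviation edges :: "'v graph \<Rightarrow> 'v set set" where
  "edges G \<equiv> snd G"

definition is_graph :: "'v graph \<Rightarrow> bool" where
  "is_graph G \<longleftrightarrow> finite (verts G) \<and> (\<forall>e\<in>edges G. e \<subseteq> verts G \<and> card e = 2)"

definition graph_iso :: "'v graph \<Rightarrow> 'w graph \<Rightarrow> bool" where
  "graph_iso G H \<longleftrightarrow>
     (\<exists>f. bij_betw f (verts G) (verts H) \<and>
          (\<forall>u\<in>verts G. \<forall>v\<in>verts G. {u, v} \<in> edges G \<longleftrightarrow> {f u, f v} \<in> edges H))"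

definition subgraph_of :: "'v graph \<Rightarrow> 'v graph \<Rightarrow> bool" where
  "subgraph_of H G \<longleftrightarrow> is_graph H \<and> verts H \<subseteq> verts G \<and> edges H \<subseteq> edges G"

definition delete_edge :: "'v graph \<Rightarrow> 'v set \<Rightarrow> 'v graph" where
  "delete_edge G e = (verts G, edges G - {e})"

definition delete_vertex :: "'v graph \<Rightarrow> 'v \<Rightarrow> 'v graph" where
  "delete_vertex G v = (verts G - {v}, {e \<in> edges G. v \<notin> e})"

text \<open>A path is given by its nonempty list of pairwise distinct vertices; a single vertex is a path.\<close>

definition is_path :: "'v graph \<Rightarrow> 'v list \<Rightarrow> bool" where
  "is_path G p \<longleftrightarrow> p \<noteq> [] \<and> distinct p \<and> set p \<subseteq> verts G \<and>
     (\<forall>i. Suc i < length p \<longrightarrow> {p ! i, p ! Suc i} \<in> edges G)"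

definition path_edges :: "'v list \<Rightarrow> 'v set set" where
  "path_edges p = {{p ! i, p ! Suc i} | i. Suc i < length p}"

definition reachable_rel :: "'v graph \<Rightarrow> ('v \<times> 'v) set" where
  "reachable_rel G = {(u, v). \<exists>p. is_path G p \<and> hd p = u \<and> last p = v}"

definition components_of_graph :: "'v graph \<Rightarrow> 'v set set" where
  "components_of_graph G = verts G // reachable_rel G"

definition connected_graph :: "'v graph \<Rightarrow> bool" where
  "connected_graph G \<longleftrightarrow> card (components_of_graph G) = 1"

definition is_bridge :: "'v graph \<Rightarrow> 'v set \<Rightarrow> bool" where
  "is_bridge G e \<longleftrightarrow> e \<in> edges G \<and>
     card (components_of_graph (delete_edge G e)) > card (components_of_graph G)"

definition is_isolated :: "'v graph \<Rightarrow> 'v \<Rightarrow> bool" where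
  "is_isolated G v \<longleftrightarrow> v \<in> verts G \<and> (\<forall>e\<in>edges G. v \<notin> e)"

definition two_connected :: "'v graph \<Rightarrow> bool" where
  "two_connected G \<longleftrightarrow> is_graph G \<and> card (verts G) \<ge> 3 \<and> connected_graph G \<and>
     (\<forall>v\<in>verts G. connected_graph (delete_vertex G v))"

definition maximal_two_connected_in :: "'v graph \<Rightarrow> 'v graph \<Rightarrow> bool" where
  "maximal_two_connected_in G B \<longleftrightarrow> subgraph_of B G \<and> two_connected B \<and>
     (\<forall>H. subgraph_of H G \<and> two_connected H \<and> subgraph_of B H \<longrightarrow> H = B)"

definition blocks :: "'v graph \<Rightarrow> 'v graph set" where
  "blocks G = {B. maximal_two_connected_in G B}
     \<union> {(e, {e}) | e. is_bridge G e}
     \<union> {({v}, {}) | v. is_isolated G v}"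

definition passes_through :: "'v list \<Rightarrow> 'v graph \<Rightarrow> bool" where
  "passes_through p B \<longleftrightarrow> path_edges p \<inter> edges B \<noteq> {} \<or> (\<exists>v. p = [v] \<and> B = ({v}, {}))"

text \<open>A finite graph has finitely many paths, so the supremum is a maximum as soon as there is
  a vertex; it is 0 for the graph without vertices.\<close>

definition block_diameter :: "'v graph \<Rightarrow> nat" where
  "block_diameter G = (SUP p\<in>{p. is_path G p}. card {B \<in> blocks G. passes_through p B})"

text \<open>Every finite graph is isomorphic to one whose vertices are natural numbers, so a class of
  graphs closed under isomorphism is determined by its members of type \<^typ>\<open>nat graph\<close>.\<close>

definition graph_class :: "nat graph set \<Rightarrow> bool" where
  "graph_class \<A> \<longleftrightarrow> (\<forall>G\<in>\<A>. is_graph G) \<and>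
     (\<forall>G\<in>\<A>. \<forall>H. is_graph H \<and> graph_iso G H \<longrightarrow> H \<in> \<A>)"

definition block_stable :: "nat graph set \<Rightarrow> bool" where
  "block_stable \<A> \<longleftrightarrow> (\<forall>G. is_graph G \<longrightarrow> (G \<in> \<A> \<longleftrightarrow> blocks G \<subseteq> \<A>))"

definition members_on :: "nat graph set \<Rightarrow> nat \<Rightarrow> nat graph set" where
  "members_on \<A> n = {G \<in> \<A>. verts G = {1..n}}"

lemma finite_members_on:
  assumes "graph_class \<A>"
  shows "finite (members_on \<A> n)"
proof (rule finite_subset)
  show "members_on \<A> n \<subseteq> {{1..n}} \<times> Pow (Pow {1..n})"
    using assms by (fastforce simp: members_on_def graph_class_def is_graph_def)
qed simp

lemma finite_paths:
  assumes "is_graph G"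
  shows "finite {p. is_path G p}"
proof (rule finite_subset)
  show "{p. is_path G p} \<subseteq> {p. set p \<subseteq> verts G \<and> length p \<le> card (verts G)}"
    using assms by (auto simp: is_path_def is_graph_def)
      (metis card_mono distinct_card)
  show "finite {p. set p \<subseteq> verts G \<and> length p \<le> card (verts G)}"
    using assms by (intro finite_lists_length_le) (simp add: is_graph_def)
qed

end

theory Submission imports Defs begin

text \<open>Root the component of a vertex \<open>x\<close> at \<open>x\<close>. Each block, minus its vertex nearest to \<open>x\<close>, is a petal; the
  petals partition the other vertices of the component, and the graph is recovered from the
  petals together with the map \<open>f\<close> sending each petal to the vertex it hangs from. Since the class is
  block-stable, replacing \<open>f\<close> by any other acyclic map gives again a member of the class, so
  conditionally on the petals \<open>f\<close> is a uniformly random acyclic map, and a path meets at most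
  twice as many blocks as the largest depth of a petal.

  Absorbing a petal into the one it hangs from shows that there are \<open>m * n ^ (q - 1)\<close> acyclic maps
  for \<open>q\<close> petals, \<open>n\<close> vertices and \<open>m\<close> roots, and that a fixed petal has depth greater than \<open>h\<close>
  with probability at most \<open>exp (- h\<^sup>2 / (2 * n))\<close>. A union bound over the petals would lose a power
  of \<open>n\<close>. Instead cut at half of the desired height \<open>k\<close>: given the part below the cut, the part above
  it is again a uniform acyclic map, on the \<open>N\<close> vertices above the cut. By Markov's inequality
  \<open>N > n / 16\<close> is unlikely, and if \<open>N \<le> n / 16\<close> then induction on \<open>n\<close> applies with a much better exponent.

  To pass from components to the whole graph, each vertex of a bad component is given weight
  \<open>1 / u\<close>, \<open>u\<close> being the size of the component: \<open>exp (- a / u) / u\<close> increases with \<open>u\<close>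
  as long as \<open>u \<le> a\<close>.\<close>

subsection \<open>Uniform acyclic attachment maps\<close>

text \<open>Petal systems are abstract because the part above a cut is no longer rooted at one
  vertex: every vertex of depth exactly h becomes a root, so the count must allow any number m of
  roots. Fixing the vertex from which petal i hangs amounts to merging i with the petal of that
  vertex, or with the roots, and leaves an acyclic map with one petal fewer. Repeating this along
  the ancestors of i, the merged petal gains at least one vertex per step, so the k-th step avoids
  at least k of the n vertices; the product of the factors 1 - k / n is at most exp (- h^2 / (2 n)).
  For the cut, put y = exp (- k^2 / (64 n)). Markov's inequality costs 16 y^2, and the part above
  the cut, with at least half of the height but at most n / 16 vertices, costs 32 y^4; both fit
  under 32 y once y < 1 / 32. The factor 2 for paths arises because the branch above a petal can be
  entered or left only through the vertex it hangs from, so a path cannot do both: a petal that it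
  meets is an ancestor of one of its two ends.\<close>

text \<open>\<open>own v\<close> is the petal containing \<open>v\<close>, or \<open>None\<close> if \<open>v\<close> is a root. On a cycle of petals no
  depth exists, so acyclicity of \<open>f\<close> means that every petal has a depth.\<close>

inductive depth :: "('v \<Rightarrow> 'i option) \<Rightarrow> ('i \<Rightarrow> 'v) \<Rightarrow> 'i option \<Rightarrow> nat \<Rightarrow> bool"
  for own :: "'v \<Rightarrow> 'i option" and f :: "'i \<Rightarrow> 'v" where
  depth_None: "depth own f None 0"
| depth_Some: "depth own f (own (f i)) n \<Longrightarrow> depth own f (Some i) (Suc n)"

lemma depth_Some_iff: "depth own f (Some i) n \<longleftrightarrow> (\<exists>m. n = Suc m \<and> depth own f (own (f i)) m)"
  by (subst depth.simps) simp

lemma depth_None_iff: "depth own f None n \<longleftrightarrow> n = 0"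
  by (subst depth.simps) simp

lemma depth_unique:
  assumes "depth own f a n" "depth own f a m"
  shows "m = n"
  using assms
proof (induction arbitrary: m)
  case depth_None
  then show ?case by (simp only: depth_None_iff)
next
  case (depth_Some i n)
  from depth_Some.prems obtain k where "m = Suc k" "depth own f (own (f i)) k"
    unfolding depth_Some_iff by blast
  then show ?case using depth_Some.IH by simp
qed

definition attachments :: "'v set \<Rightarrow> 'i set \<Rightarrow> ('v \<Rightarrow> 'i option) \<Rightarrow> ('i \<Rightarrow> 'v) set" where
  "attachments V I own = {f \<in> I \<rightarrow>\<^sub>E V. \<forall>i\<in>I. \<exists>n. depth own f (Some i) n}"

definition petal_system :: "'v set \<Rightarrow> 'i set \<Rightarrow> ('v \<Rightarrow> 'i option) \<Rightarrow> bool" where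
  "petal_system V I own \<longleftrightarrow> finite V \<and> finite I \<and> (\<forall>v\<in>V. own v \<in> insert None (Some ` I)) \<and>
     (\<forall>i\<in>I. \<exists>v\<in>V. own v = Some i)"

text \<open>Merges petal \<open>i\<close> into \<open>a\<close>; with \<open>a = own (f i)\<close>
  this is the contraction of \<open>i\<close> along its link to the petal that it hangs
  from.\<close>

definition absorb :: "'i \<Rightarrow> 'i option \<Rightarrow> ('v \<Rightarrow> 'i option) \<Rightarrow> 'v \<Rightarrow> 'i option" where
  "absorb i a own w = (if own w = Some i then a else own w)"

lemma finite_attachments:
  assumes "petal_system V I own"
  shows "finite (attachments V I own)"
proof (rule finite_subset)
  show "attachments V I own \<subseteq> I \<rightarrow>\<^sub>E V" by (auto simp: attachments_def)
  show "finite (I \<rightarrow>\<^sub>E V)" using assms by (intro finite_PiE) (simp_all add: petal_system_def)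
qed

lemma petal_system_absorb:
  assumes "petal_system V I own" "i \<in> I" "v \<in> V" "own v \<noteq> Some i"
  shows "petal_system V (I - {i}) (absorb i (own v) own)"
  unfolding petal_system_def
proof (intro conjI ballI)
  show "finite V" "finite (I - {i})" using assms(1) by (auto simp: petal_system_def)
next
  fix w assume "w \<in> V"
  then have "own w \<in> insert None (Some ` I)" "own v \<in> insert None (Some ` I)"
    using assms by (auto simp: petal_system_def)
  then show "absorb i (own v) own w \<in> insert None (Some ` (I - {i}))"
    using assms(4) by (auto simp: absorb_def)
next
  fix j assume j: "j \<in> I - {i}"
  then obtain w where "w \<in> V" "own w = Some j" using assms(1) by (auto simp: petal_system_def)
  then show "\<exists>w\<in>V. absorb i (own v) own w = Some j" using j by (intro bexI[of _ w]) (auto simp: absorb_def)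
qed

section \<open>Depths under absorption of one petal\<close>

lemma depth_not_loop:
  assumes "depth own f (Some i) n"
  shows "own (f i) \<noteq> Some i"
proof
  assume "own (f i) = Some i"
  moreover obtain m where "n = Suc m" "depth own f (own (f i)) m"
    using assms unfolding depth_Some_iff by blast
  ultimately show False using depth_unique[OF assms, of m] by simp
qed

text \<open>The chain from \<open>a\<close> to the roots survives with \<open>i\<close> cut out of
  it; \<open>i\<close> itself, no longer a petal, is replaced by what absorbed it. The length may
  drop, so only existence is claimed.\<close>

lemma depth_absorb:
  assumes "own (f i) \<noteq> Some i" "depth own f a n"
  shows "\<exists>m. depth (absorb i (own (f i)) own) f (if a = Some i then own (f i) else a) m"
  using assms(2)
proof induction
  case depth_None
  then show ?case by (auto simp: depth_Some_iff depth_None_iff)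
next
  case (depth_Some j n)
  show ?case
  proof (cases "j = i")
    case True
    then show ?thesis using depth_Some.IH assms(1) by auto
  next
    case False
    from depth_Some.IH obtain m where
      "depth (absorb i (own (f i)) own) f (absorb i (own (f i)) own (f j)) m"
      by (auto simp: absorb_def[of _ _ _ "f j"])
    then show ?thesis using False by (auto simp: depth_Some_iff depth_None_iff)
  qed
qed

text \<open>Undoing the absorption at most inserts \<open>i\<close> into a chain, just before the
  petal that had absorbed it.\<close>

lemma depth_unabsorb:
  assumes "v = f i" "own v \<noteq> Some i" "depth (absorb i (own v) own) f a n" "a \<noteq> Some i"
  shows "\<exists>m. depth own f a m"
  using assms(3,4)
proof induction
  case depth_None
  then show ?case by (auto simp: depth_Some_iff depth_None_iff)
next
  case (depth_Some j n)
  have "absorb i (own v) own (f j) \<noteq> Some i" using assms(2) by (auto simp: absorb_def)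
  then obtain m where m: "depth own f (absorb i (own v) own (f j)) m" using depth_Some by auto
  have "\<exists>m. depth own f (own (f j)) m"
  proof (cases "own (f j) = Some i")
    case True
    then show ?thesis using m assms(1) by (auto simp: absorb_def depth_Some_iff depth_None_iff)
  next
    case False
    then show ?thesis using m by (auto simp: absorb_def)
  qed
  then show ?case by (auto simp: depth_Some_iff depth_None_iff)
qed

text \<open>Depth drops strictly along a chain, so the chain of something shallower than
  \<open>i\<close> cannot contain \<open>i\<close>. What becomes of \<open>i\<close> is therefore
  immaterial, and \<open>b\<close> is arbitrary.\<close>

lemma depth_absorb_same:
  assumes "depth own f (Some i) (Suc m)" "depth own f a k" "k \<le> m"
  shows "depth (absorb i b own) f a k"
  using assms(2,3)
proof induction
  case depth_None
  then show ?case by (auto simp: depth_Some_iff depth_None_iff)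
next
  case (depth_Some j k)
  have "own (f j) \<noteq> Some i" 
    using depth_unique[OF assms(1), of k] depth_Some by auto
  then show ?case using depth_Some by (auto simp: absorb_def depth_Some_iff)
qed

text \<open>A chain that starts in \<open>J\<close> stays in \<open>J\<close> and consults no other
  value of the map. This allows passing between \<open>g\<close> and
  \<open>g(i := v)\<close>.\<close>

lemma depth_cong_own:
  assumes "\<And>j. j \<in> J \<Longrightarrow> f j = g j" 
    and "\<And>j. j \<in> J \<Longrightarrow> own (f j) \<in> insert None (Some ` J)"
    and "depth own f a n" "a \<in> insert None (Some ` J)"
  shows "depth own g a n"
  using assms(3,4)
proof induction
  case depth_None
  show ?case by (rule depth.intros)
next
  case (depth_Some i n)
  then have "i \<in> J" by auto
  then show ?case using assms(1)[of i] assms(2)[of i] depth_Some by (auto simp: depth_Some_iff)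
qed

lemma absorb_range:
  assumes "petal_system V I own" "i \<in> I" "v \<in> V" "own v \<noteq> Some i" "w \<in> V"
  shows "absorb i (own v) own w \<in> insert None (Some ` (I - {i}))"
  using petal_system_absorb[OF assms(1-4)] assms(5) by (auto simp: petal_system_def)

text \<open>Prescribing \<open>f i = v\<close> makes \<open>i\<close> and the petal of
  \<open>v\<close> one unit: a cycle through \<open>i\<close> is a cycle through the merged petal.
  Acyclicity can thus be tested after the absorption, with one petal fewer.\<close>

lemma attachments_fiber:
  assumes ps: "petal_system V I own" and i: "i \<in> I" and v: "v \<in> V" "own v \<noteq> Some i"
  shows "bij_betw (\<lambda>g. g(i := v)) (attachments V (I - {i}) (absorb i (own v) own))
     {f \<in> attachments V I own. f i = v}"
proof (rule bij_betw_byWitness[where f' = "\<lambda>f. f(i := undefined)"])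
  let ?own = "absorb i (own v) own"
  show "\<forall>a\<in>attachments V (I - {i}) ?own. (a(i := v))(i := undefined) = a"
    by (auto simp: attachments_def PiE_def extensional_def fun_eq_iff)
  show "\<forall>a'\<in>{f \<in> attachments V I own. f i = v}. (a'(i := undefined))(i := v) = a'"
    by auto
  show "(\<lambda>g. g(i := v)) ` attachments V (I - {i}) ?own \<subseteq> {f \<in> attachments V I own. f i = v}"
  proof clarsimp
    fix g assume g: "g \<in> attachments V (I - {i}) ?own"
    then have gP: "g \<in> (I - {i}) \<rightarrow>\<^sub>E V" by (auto simp: attachments_def)
    have P: "g(i := v) \<in> I \<rightarrow>\<^sub>E V" using gP i v(1)
      by (auto simp: PiE_def extensional_def Pi_def)
    have d: "\<exists>n. depth own (g(i := v)) (Some j) n" if j: "j \<in> I" "j \<noteq> i" for j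
    proof -
      from g j obtain n where "depth ?own g (Some j) n" by (auto simp: attachments_def)
      then have "depth ?own (g(i := v)) (Some j) n"
      proof (rule depth_cong_own[where J = "I - {i}", rotated 2])
        fix k assume "k \<in> I - {i}"
        then have "g k \<in> V" using gP by auto
        then show "?own (g k) \<in> insert None (Some ` (I - {i}))"
          by (rule absorb_range[OF ps i v])
      qed (use j in auto)
      then show ?thesis using depth_unabsorb[of v "g(i := v)" i own "Some j"] v j by auto
    qed
    have "\<exists>n. depth own (g(i := v)) (own v) n"
    proof (cases "own v")
      case None
      then show ?thesis by (auto simp: depth_Some_iff depth_None_iff)
    next
      case (Some j)
      then show ?thesis using d[of j] v ps by (auto simp: petal_system_def)
    qed
    then have "\<exists>n. depth own (g(i := v)) (Some i) n" by (auto simp: depth_Some_iff)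
    then show "g(i := v) \<in> attachments V I own"
      using P d by (auto simp: attachments_def)
  qed
  show "(\<lambda>f. f(i := undefined)) ` {f \<in> attachments V I own. f i = v} \<subseteq> attachments V (I - {i}) ?own"
  proof clarsimp
    fix f assume f: "f \<in> attachments V I own" and fi: "v = f i"
    then have fP: "f \<in> I \<rightarrow>\<^sub>E V" by (auto simp: attachments_def)
    have P: "f(i := undefined) \<in> (I - {i}) \<rightarrow>\<^sub>E V" using fP
      by (auto simp: PiE_def extensional_def Pi_def)
    have "\<exists>n. depth (absorb i (own (f i)) own) (f(i := undefined)) (Some j) n" if j: "j \<in> I" "j \<noteq> i" for j
    proof -
      from f j obtain n where "depth own f (Some j) n" by (auto simp: attachments_def)
      from depth_absorb[OF _ this, of i] obtain m where "depth ?own f (Some j) m"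
        using v fi j by auto
      then have "depth ?own (f(i := undefined)) (Some j) m"
      proof (rule depth_cong_own[where J = "I - {i}", rotated 2])
        fix k assume "k \<in> I - {i}"
        then have "f k \<in> V" using fP by auto
        then show "?own (f k) \<in> insert None (Some ` (I - {i}))"
          by (rule absorb_range[OF ps i v])
      qed (use j in auto)
      then show ?thesis using fi by auto
    qed
    then show "f(i := undefined) \<in> attachments V (I - {i}) (absorb i (own (f i)) own)"
      using P by (auto simp: attachments_def)
  qed
qed

section \<open>Counting acyclic maps by absorption\<close>

lemma attachments_split:
  assumes ps: "petal_system V I own" and i: "i \<in> I"
  shows "attachments V I own = (\<Union>v\<in>{v\<in>V. own v \<noteq> Some i}. {f \<in> attachments V I own. f i = v})"
  using i by (auto simp: attachments_def dest: depth_not_loop)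

lemma card_attachments_split:
  assumes ps: "petal_system V I own" and i: "i \<in> I"
  shows "card (attachments V I own) =
    (\<Sum>v\<in>{v\<in>V. own v \<noteq> Some i}. card (attachments V (I - {i}) (absorb i (own v) own)))"
proof -
  have "card (attachments V I own) = (\<Sum>v\<in>{v\<in>V. own v \<noteq> Some i}. card {f \<in> attachments V I own. f i = v})"
    by (subst attachments_split[OF ps i], subst card_UN_disjoint)
      (use ps finite_attachments[OF ps] in \<open>auto simp: petal_system_def\<close>)
  also have "\<dots> = (\<Sum>v\<in>{v\<in>V. own v \<noteq> Some i}. card (attachments V (I - {i}) (absorb i (own v) own)))"
    by (intro sum.cong refl) (use bij_betw_same_card[OF attachments_fiber[OF ps i]] in auto)
  finally show ?thesis .
qed

text \<open>The argument \<open>None\<close> gives the set of roots, so roots and petals are counted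
  alike.\<close>

definition petal :: "'v set \<Rightarrow> ('v \<Rightarrow> 'i option) \<Rightarrow> 'i option \<Rightarrow> 'v set" where
  "petal V own a = {v\<in>V. own v = a}"

lemma petal_absorb:
  assumes "own v \<noteq> Some i" 
  shows "petal V (absorb i (own v) own) (own v) = petal V own (own v) \<union> petal V own (Some i)"
    and "a \<noteq> own v \<Longrightarrow> a \<noteq> Some i \<Longrightarrow> petal V (absorb i (own v) own) a = petal V own a"
  using assms by (auto simp: petal_def absorb_def)

lemma card_petal_absorb:
  assumes "own v \<noteq> Some i" "finite V"
  shows "card (petal V (absorb i (own v) own) (own v)) = card (petal V own (own v)) + card (petal V own (Some i))"
  using assms by (subst petal_absorb, simp, subst card_Un_disjoint) (auto simp: petal_def)

lemma card_petal_split: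
  assumes "finite V"
  shows "card V = card (petal V own None) + card (petal V own (Some i))
     + card {v\<in>V. own v \<noteq> None \<and> own v \<noteq> Some i}"
proof -
  have "V = petal V own None \<union> petal V own (Some i) \<union> {v\<in>V. own v \<noteq> None \<and> own v \<noteq> Some i}"
    by (auto simp: petal_def)
  then have "card V = card (petal V own None \<union> petal V own (Some i) \<union> {v\<in>V. own v \<noteq> None \<and> own v \<noteq> Some i})"
    by simp
  also have "\<dots> = card (petal V own None) + card (petal V own (Some i))
     + card {v\<in>V. own v \<noteq> None \<and> own v \<noteq> Some i}"
    using assms by (subst card_Un_disjoint; (subst card_Un_disjoint)?) (auto simp: petal_def)
  finally show ?thesis .
qed

text \<open>Generalises Cayley's formula for forests with prescribed roots, which is the case of
  one-vertex petals. Absorbing a petal of size \<open>s\<close> into a root leaves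
  \<open>m + s\<close> roots, absorbing it elsewhere leaves \<open>m\<close>; with \<open>c\<close>
  vertices elsewhere, \<open>m * (m + s) + c * m = m * n\<close>.\<close>

theorem card_attachments:
  assumes "petal_system V I own" "I \<noteq> {}"
  shows "card (attachments V I own) = card (petal V own None) * card V ^ (card I - 1)"
  using assms
proof (induction "card I" arbitrary: I own)
  case 0
  then show ?case by (auto simp: petal_system_def)
next
  case (Suc q)
  note ps = Suc.prems(1)
  from Suc.prems obtain i where i: "i \<in> I" by auto
  have fin: "finite V" "finite I" using ps by (auto simp: petal_system_def)
  let ?c = "\<lambda>v. card (attachments V (I - {i}) (absorb i (own v) own))"
  let ?m = "card (petal V own None)" and ?s = "card (petal V own (Some i))"
  let ?X = "{v\<in>V. own v \<noteq> None \<and> own v \<noteq> Some i}"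
  have q: "card (I - {i}) = q" using Suc.hyps(2) i fin by simp
  have X: "{v\<in>V. own v \<noteq> Some i} = petal V own None \<union> ?X" by (auto simp: petal_def)
  have eq: "card (attachments V I own) = (\<Sum>v\<in>petal V own None. ?c v) + (\<Sum>v\<in>?X. ?c v)"
    unfolding card_attachments_split[OF ps i] X
    by (rule sum.union_disjoint) (use fin in \<open>auto simp: petal_def\<close>)
  show ?case
  proof (cases "q = 0")
    case True
    then have "I - {i} = {}" using q fin by (metis card_0_eq finite_Diff)
    then have I: "I = {i}" using i by auto
    have "?X = {}" using ps by (auto simp: petal_system_def I)
    moreover have "?c v = 1" for v unfolding I by (simp add: attachments_def)
    ultimately show ?thesis unfolding eq \<open>?X = {}\<close> using True q by (simp add: Suc.hyps(2)[symmetric])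
  next
    case False
    then have ne: "I - {i} \<noteq> {}" using q by (metis card.empty)
    have 1: "?c v = (?m + ?s) * card V ^ (q - 1)" if "v \<in> petal V own None" for v
    proof -
      have v: "v \<in> V" "own v \<noteq> Some i" "own v = None" using that by (auto simp: petal_def)
      show ?thesis
        using Suc.hyps(1)[OF _ petal_system_absorb[OF ps i v(1,2)] ne] q card_petal_absorb[of own v i V, OF v(2) fin(1)] v(3)
        by simp
    qed
    have 2: "?c v = ?m * card V ^ (q - 1)" if "v \<in> ?X" for v
    proof -
      have v: "v \<in> V" "own v \<noteq> Some i" "own v \<noteq> None" using that by (auto simp: petal_def)
      show ?thesis
        using Suc.hyps(1)[OF _ petal_system_absorb[OF ps i v(1,2)] ne] q petal_absorb(2)[of own v i None V, OF v(2)] v(3)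
        by simp
    qed
    have "card (attachments V I own) = ?m * ((?m + ?s) * card V ^ (q - 1)) + card ?X * (?m * card V ^ (q - 1))"
      unfolding eq using 1 2 by simp
    also have "\<dots> = ?m * ((?m + ?s + card ?X) * card V ^ (q - 1))" by (simp add: algebra_simps)
    also have "?m + ?s + card ?X = card V" using card_petal_split[OF fin(1), of own i] by simp
    also have "card V * card V ^ (q - 1) = card V ^ q" using False by (cases q) auto
    also have "q = card I - 1" using Suc.hyps(2) by linarith
    finally show ?thesis .
  qed
qed

text \<open>The size bound \<open>s\<close> is carried along for the induction. A petal deeper than
  \<open>h + 1\<close> hangs from a vertex outside the roots and outside itself, which leaves at
  most \<open>n - s \<le> n * exp (- s / n)\<close> choices; absorbing it there yields a petal of
  size at least \<open>s + 1\<close> that must be deeper than \<open>h\<close>.\<close>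

lemma card_depth_greater:
  assumes "petal_system V I own" "i \<in> I" "s \<le> card (petal V own (Some i))"
  shows "real (card {f \<in> attachments V I own. \<exists>n>h. depth own f (Some i) n})
    \<le> real (card (petal V own None) * card V ^ (card I - 1)) * exp (- (\<Sum>k<h. real (s + k)) / real (card V))"
  using assms
proof (induction h arbitrary: I own i s)
  case 0
  have "card {f \<in> attachments V I own. \<exists>n>0. depth own f (Some i) n} \<le> card (attachments V I own)"
    by (rule card_mono[OF finite_attachments[OF 0(1)]]) auto
  also have "\<dots> = card (petal V own None) * card V ^ (card I - 1)"
    by (rule card_attachments) (use 0 in auto)
  finally show ?case unfolding lessThan_0 sum.empty by (simp only: minus_zero div_0 exp_zero mult_1_right of_nat_le_iff)
next
  case (Suc h)
  note ps = Suc.prems(1) and i = Suc.prems(2)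
  have fin: "finite V" "finite I" using ps by (auto simp: petal_system_def)
  let ?B = "\<lambda>I own i h. {f \<in> attachments V I own. \<exists>n>h. depth own f (Some i) n}"
  let ?X = "{v\<in>V. own v \<noteq> None \<and> own v \<noteq> Some i}"
  let ?m = "card (petal V own None)"
  let ?S = "\<lambda>v. (\<lambda>g. g(i := v)) ` ?B (I - {i}) (absorb i (own v) own) (the (own v)) h"
  let ?e = "exp (- (\<Sum>k<h. real (Suc s + k)) / real (card V))"
  \<comment> \<open>On \<open>?X\<close> the owner is never \<open>None\<close>, so
    \<open>the\<close> is harmless. The chain of the petal below \<open>i\<close> does not contain
    \<open>i\<close>, hence keeps its length under the absorption.\<close>
  have sub: "?B I own i (Suc h) \<subseteq> (\<Union>v\<in>?X. ?S v)"
  proof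
    fix f assume "f \<in> ?B I own i (Suc h)"
    then obtain n where f: "f \<in> attachments V I own" and n: "n > Suc h" "depth own f (Some i) n" by auto
    then obtain m where m: "n = Suc m" "depth own f (own (f i)) m" by (auto simp: depth_Some_iff)
    have fi: "f i \<in> V" using f i by (auto simp: attachments_def)
    obtain j where j: "own (f i) = Some j"
      using m n by (cases "own (f i)") (auto simp: depth_None_iff)
    have ni: "own (f i) \<noteq> Some i" using n(2) by (rule depth_not_loop)
    have "f \<in> {f \<in> attachments V I own. f i = f i}" using f by auto
    then obtain g where g: "g \<in> attachments V (I - {i}) (absorb i (own (f i)) own)" "f = g(i := f i)"
      using attachments_fiber[OF ps i fi ni] f by (auto simp: bij_betw_def)
    have "depth (absorb i (own (f i)) own) f (own (f i)) m"
      by (rule depth_absorb_same[of own f i m]) (use m n in auto)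
    then have "depth (absorb i (own (f i)) own) g (own (f i)) m"
    proof (rule depth_cong_own[where J = "I - {i}", rotated 2])
      show "own (f i) \<in> insert None (Some ` (I - {i}))" using fi ni ps by (auto simp: petal_system_def)
      fix k assume k: "k \<in> I - {i}"
      then show "f k = g k" using g(2) by (metis DiffE fun_upd_other singletonI)
      from k have "f k \<in> V" using f by (auto simp: attachments_def)
      then show "absorb i (own (f i)) own (f k) \<in> insert None (Some ` (I - {i}))"
        by (rule absorb_range[OF ps i fi ni])
    qed
    then have "f \<in> ?S (f i)" using g n m j by (auto intro!: image_eqI[of _ _ g])
    moreover have "f i \<in> ?X" using fi ni j by simp
    ultimately show "f \<in> (\<Union>v\<in>?X. ?S v)" by (rule UN_I[rotated])
  qed
  have fS: "finite (?B (I - {i}) (absorb i (own v) own) (the (own v)) h)" if "v \<in> ?X" for v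
    using finite_attachments[OF petal_system_absorb[OF ps i, of v]] that by auto
  have step: "real (card (?S v)) \<le> real (?m * card V ^ (card I - 2)) * ?e" if "v \<in> ?X" for v
  proof -
    from that obtain j where v: "v \<in> V" "own v \<noteq> Some i" and j: "own v = Some j" "j \<in> I - {i}"
      using ps by (auto simp: petal_system_def)
    have "card (petal V own (Some j)) \<ge> 1"
      using ps j fin by (auto simp: petal_system_def petal_def Suc_le_eq card_gt_0_iff)
    then have "Suc s \<le> card (petal V (absorb i (own v) own) (Some j))"
      using card_petal_absorb[of own v i V, OF v(2) fin(1)] j Suc.prems(3) by auto
    note IH = Suc.IH[OF petal_system_absorb[OF ps i v] j(2) this]
    have m: "petal V (absorb i (own v) own) None = petal V own None"
      using petal_absorb(2)[of own v i None V, OF v(2)] j by auto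
    have q: "card (I - {i}) - 1 = card I - 2" using fin i by simp
    have "card (?S v) \<le> card (?B (I - {i}) (absorb i (own v) own) (the (own v)) h)"
      by (rule card_image_le[OF fS[OF that]])
    then have "real (card (?S v)) \<le> real (card (?B (I - {i}) (absorb i (own v) own) j h))"
      unfolding j(1) option.sel of_nat_le_iff .
    also note IH[unfolded m q]
    finally show ?thesis .
  qed
  show ?case
  proof (cases "?X = {}")
    case True
    have "?B I own i (Suc h) = {}" using sub unfolding True by blast
    then show ?thesis by (simp only: card.empty) simp
  next
    case False
    then have n0: "card V > 0" using fin by (auto simp: card_gt_0_iff)
    from False obtain j where j: "j \<in> I" "j \<noteq> i" using ps by (auto simp: petal_system_def)
    then have "card {i, j} \<le> card I" using i fin by (intro card_mono) auto
    \<comment> \<open>A nonempty \<open>?X\<close> provides a second petal, so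
      \<open>card I - 2\<close> is not truncated.\<close>
    then have I2: "card I \<ge> 2" using j by simp
    let ?M = "real (?m * card V ^ (card I - 2)) * ?e"
    have "real (card (?B I own i (Suc h))) \<le> real (card (\<Union>v\<in>?X. ?S v))"
      using fS by (intro of_nat_mono card_mono[OF _ sub]) (use fin in auto)
    also have "\<dots> \<le> (\<Sum>v\<in>?X. real (card (?S v)))"
      unfolding of_nat_sum[symmetric] by (intro of_nat_mono card_UN_le) (use fin in auto)
    also have "\<dots> \<le> real (card ?X) * ?M"
      by (rule sum_bounded_above) (rule step)
    finally have B: "real (card (?B I own i (Suc h))) \<le> real (card ?X) * ?M" .
    have "card ?X + s \<le> card V" using card_petal_split[OF fin(1), of own i] Suc.prems(3) by linarith
    then have "real (card ?X) \<le> real (card V) - real s" by linarith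
    also have "\<dots> = real (card V) * (1 + - real s / real (card V))"
      using n0 by (simp add: algebra_simps)
    also have "\<dots> \<le> real (card V) * exp (- real s / real (card V))"
      by (intro mult_left_mono exp_ge_add_one_self) simp
    finally have X: "real (card ?X) * ?M \<le> (real (card V) * exp (- real s / real (card V))) * ?M"
      by (rule mult_right_mono) simp
    have e: "exp (- real s / real (card V)) * ?e = exp (- (\<Sum>k<Suc h. real (s + k)) / real (card V))"
      unfolding exp_add[symmetric] sum.lessThan_Suc_shift by (simp add: add_divide_distrib diff_divide_distrib)
    have "card I - 1 = Suc (card I - 2)" using I2 by linarith
    then have p: "card V ^ (card I - 1) = card V * card V ^ (card I - 2)" by (simp only: power_Suc)
    have "(n * a) * ((m * r) * b) = (m * (n * r)) * (a * b)" for n a m r b :: real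
      by (simp add: algebra_simps)
    note eq = this[of "real (card V)" "exp (- real s / real (card V))" "real ?m" "real (card V ^ (card I - 2))" ?e,
        folded of_nat_mult, unfolded e, folded p]
    show ?thesis using order_trans[OF B X] unfolding eq .
  qed
qed

text \<open>With \<open>s = 1\<close> the sum in the exponent is \<open>h * (h + 1) / 2\<close>,
  which is at least \<open>h^2 / 2\<close>.\<close>

corollary card_depth_greater_exp:
  assumes ps: "petal_system V I own" and i: "i \<in> I"
  shows "real (card {f \<in> attachments V I own. \<exists>n>h. depth own f (Some i) n})
    \<le> real (card (attachments V I own)) * exp (- (real h ^ 2) / (2 * real (card V)))"
proof -
  have ne: "I \<noteq> {}" using i by auto
  have "1 \<le> card (petal V own (Some i))"
    using ps i by (auto simp: petal_system_def petal_def Suc_le_eq card_gt_0_iff)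
  from card_depth_greater[OF ps i this, of h]
  have "real (card {f \<in> attachments V I own. \<exists>n>h. depth own f (Some i) n})
    \<le> real (card (attachments V I own)) * exp (- (\<Sum>k<h. real (1 + k)) / real (card V))"
    unfolding card_attachments[OF ps ne] .
  also have "\<dots> \<le> real (card (attachments V I own)) * exp (- (real h ^ 2) / (2 * real (card V)))"
  proof (intro mult_left_mono, simp only: exp_le_cancel_iff)
    have "(\<Sum>k<h. real (1 + k)) = (real h ^ 2 + real h) / 2"
      by (induction h) (simp_all add: power2_eq_square algebra_simps)
    then have "real h ^ 2 / 2 \<le> (\<Sum>k<h. real (1 + k))" by simp
    then have "real h ^ 2 / 2 / real (card V) \<le> (\<Sum>k<h. real (1 + k)) / real (card V)"
      by (rule divide_right_mono) simp
    then show "- (\<Sum>k<h. real (1 + k)) / real (card V) \<le> - (real h ^ 2) / (2 * real (card V))"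
      by (simp only: minus_divide_left[symmetric] neg_le_iff_le divide_divide_eq_left)
  qed simp
  finally show ?thesis .
qed

subsection \<open>The height of a random attachment map\<close>

text \<open>Counting substitute for conditioning on the value of \<open>key\<close>.\<close>

lemma sum_fiberwise_mono:
  fixes u w :: "'a \<Rightarrow> real"
  assumes fin: "finite A"
    and le: "\<And>a. a \<in> A \<Longrightarrow> sum u {x\<in>A. key x = key a} \<le> sum w {x\<in>A. key x = key a}"
  shows "sum u A \<le> sum w A"
proof -
  have "sum u A = (\<Sum>k\<in>key ` A. sum u {x\<in>A. key x = k})"
    using fin by (intro sum.group[symmetric]) auto
  also have "\<dots> \<le> (\<Sum>k\<in>key ` A. sum w {x\<in>A. key x = k})"
    by (rule sum_mono) (use le in auto)
  also have "\<dots> = sum w A"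
    using fin by (intro sum.group) auto
  finally show ?thesis .
qed

section \<open>Cutting an attachment map at height \<open>h\<close>\<close>

context
  fixes V :: "'v set" and I :: "'i set" and own :: "'v \<Rightarrow> 'i option" and h :: nat
begin

definition low :: "('i \<Rightarrow> 'v) \<Rightarrow> 'i set" where
  "low f = {i\<in>I. \<exists>n\<le>h. depth own f (Some i) n}"

text \<open>The bound is not strict: vertices of depth exactly \<open>h\<close> are those from which
  the petals just above the cut hang, and they become the roots of the upper system.\<close>

definition high_vertices :: "('i \<Rightarrow> 'v) \<Rightarrow> 'v set" where
  "high_vertices f = {v\<in>V. \<exists>n\<ge>h. depth own f (own v) n}"

definition high_own :: "('i \<Rightarrow> 'v) \<Rightarrow> 'v \<Rightarrow> 'i option" where
  "high_own f v = (if own v \<in> Some ` (I - low f) then own v else None)"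

text \<open>The information conditioned on: which petals lie below the cut, and where they
  hang.\<close>

definition cut_key :: "('i \<Rightarrow> 'v) \<Rightarrow> 'i set \<times> ('i \<Rightarrow> 'v)" where
  "cut_key f = (low f, restrict f (low f))"

context
  assumes ps: "petal_system V I own"
begin

lemma own_in: "v \<in> V \<Longrightarrow> own v \<in> insert None (Some ` I)"
  using ps by (auto simp: petal_system_def)

lemma depth_ex:
  assumes "f \<in> attachments V I own" "v \<in> V"
  shows "\<exists>n. depth own f (own v) n"
  using own_in[OF assms(2)] assms(1) by (auto simp: attachments_def depth_None_iff)

text \<open>A chain of length at most \<open>h\<close> runs through low petals only.\<close>

lemma depth_low_agree:
  assumes "f \<in> attachments V I own" "\<And>i. i \<in> low f \<Longrightarrow> g i = f i"
    and "depth own f a n" "n \<le> h" "a \<in> insert None (Some ` I)"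
  shows "depth own g a n"
  using assms(3-5)
proof induction
  case depth_None
  show ?case by (rule depth.intros)
next
  case (depth_Some i n)
  then have i: "i \<in> low f" by (auto simp: low_def depth_Some_iff depth_None_iff)
  then have "f i \<in> V" using assms(1) by (auto simp: attachments_def low_def)
  then have "depth own g (own (f i)) n" using depth_Some own_in by auto
  then show ?case using assms(2)[OF i] by (auto simp: depth_Some_iff)
qed

lemma low_agree:
  assumes "cut_key f = cut_key g" "i \<in> low f"
  shows "g i = f i"
  using assms by (auto simp: cut_key_def) (metis restrict_apply')

text \<open>A vertex of depth below \<open>h\<close> has the same depth for both maps, so the
  vertices below the cut, and with them those above it, are determined by the key.\<close>

lemma high_vertices_cong:
  assumes "f \<in> attachments V I own" "g \<in> attachments V I own" "cut_key f = cut_key g"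
  shows "high_vertices f = high_vertices g"
proof -
  have *: "high_vertices f \<subseteq> high_vertices g" if fg: "f \<in> attachments V I own" "g \<in> attachments V I own"
    "cut_key f = cut_key g" for f g
  proof
    fix v assume "v \<in> high_vertices f"
    then obtain n where v: "v \<in> V" and n: "n \<ge> h" "depth own f (own v) n" by (auto simp: high_vertices_def)
    obtain m where m: "depth own g (own v) m" using depth_ex[OF fg(2) v] by auto
    have "m \<ge> h"
    proof (rule ccontr)
      assume "\<not> m \<ge> h"
      then have "depth own f (own v) m"
        by (intro depth_low_agree[OF fg(2) _ m] low_agree[OF fg(3)[symmetric]])
          (use own_in[OF v] in auto)
      then show False using depth_unique n \<open>\<not> m \<ge> h\<close> by metis
    qed
    then show "v \<in> high_vertices g" using m v by (auto simp: high_vertices_def)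
  qed
  show ?thesis using *[OF assms] *[OF assms(2,1) assms(3)[symmetric]] by auto
qed

context
  fixes f0 :: "'i \<Rightarrow> 'v"
  assumes f0: "f0 \<in> attachments V I own"
begin

lemma not_low_depth: "i \<in> I - low f0 \<Longrightarrow> \<exists>n>h. depth own f0 (Some i) n"
  using f0 by (auto simp: low_def attachments_def) (metis not_le)

lemma petal_system_high: "petal_system (high_vertices f0) (I - low f0) (high_own f0)"
  unfolding petal_system_def
proof (intro conjI ballI)
  show "finite (high_vertices f0)" "finite (I - low f0)"
    using ps by (auto simp: petal_system_def high_vertices_def)
  show "high_own f0 v \<in> insert None (Some ` (I - low f0))" for v
    by (auto simp: high_own_def)
  fix i assume i: "i \<in> I - low f0"
  then obtain v where v: "v \<in> V" "own v = Some i" using ps by (auto simp: petal_system_def)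
  obtain n where "n > h" "depth own f0 (Some i) n" using not_low_depth[OF i] by auto
  then have "v \<in> high_vertices f0" using v by (auto simp: high_vertices_def intro!: exI[of _ n])
  then show "\<exists>v\<in>high_vertices f0. high_own f0 v = Some i" using v i by (auto simp: high_own_def)
qed

text \<open>Roots of the upper system have depth exactly \<open>h\<close> in the whole one, so every
  depth is shifted by exactly \<open>h\<close>.\<close>

lemma depth_glue_high:
  assumes g: "g \<in> (I - low f0) \<rightarrow>\<^sub>E high_vertices f0"
    and "depth (high_own f0) g a l" "a \<in> Some ` (I - low f0)"
  shows "depth own (\<lambda>i. if i \<in> low f0 then f0 i else g i) a (h + l)"
  using assms(2,3)
proof induction
  case depth_None
  then show ?case by auto
next
  case (depth_Some i l)
  let ?f = "\<lambda>i. if i \<in> low f0 then f0 i else g i"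
  have i: "i \<in> I - low f0" using depth_Some by auto
  then have gi: "g i \<in> high_vertices f0" using g by auto
  have "depth own ?f (own (g i)) (h + l)"
  proof (cases "own (g i) \<in> Some ` (I - low f0)")
    case True
    then show ?thesis using depth_Some by (auto simp: high_own_def)
  next
    case False
    then have l: "l = 0" using depth_Some.hyps by (auto simp: high_own_def depth_None_iff)
    from gi obtain n where n: "n \<ge> h" "depth own f0 (own (g i)) n" and V: "g i \<in> V" by (auto simp: high_vertices_def)
    \<comment> \<open>At least \<open>h\<close> because the vertex is above the cut; at most
      \<open>h\<close> because it is a root or its petal is low.\<close>
    have "n = h"
    proof (cases "own (g i)")
      case None
      then show ?thesis using n by (auto simp: depth_None_iff)
    next
      case (Some j)
      then have "j \<in> low f0" using False own_in[OF V] by auto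
      then obtain m where "m \<le> h" "depth own f0 (Some j) m" by (auto simp: low_def)
      then show ?thesis using n Some depth_unique[of own f0 "Some j" n m] by simp
    qed
    moreover have "depth own ?f (own (g i)) n"
      by (rule depth_low_agree[OF f0 _ n(2)]) (use own_in[OF V] \<open>n = h\<close> in auto)
    ultimately show ?thesis using l by simp
  qed
  then show ?case using i by (auto simp: depth_Some_iff)
qed

lemma depth_high:
  assumes f: "f \<in> attachments V I own" and key: "cut_key f = cut_key f0"
    and "depth own f a n" "a \<in> Some ` (I - low f0)"
  shows "n > h \<and> depth (high_own f0) (restrict f (I - low f0)) a (n - h)"
  using assms(3,4)
proof induction
  case depth_None
  then show ?case by auto
next
  case (depth_Some i n)
  let ?g = "restrict f (I - low f0)"
  have i: "i \<in> I - low f0" using depth_Some by auto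
  then have fi: "f i \<in> V" using f by (auto simp: attachments_def)
  have low: "low f = low f0" using key by (simp add: cut_key_def)
  have "depth own f (Some i) (Suc n)" using depth_Some.hyps by (rule depth.intros)
  moreover have "i \<in> I" "i \<notin> low f" using i low by simp_all
  ultimately have nh: "Suc n > h" unfolding low_def by (metis (mono_tags, lifting) mem_Collect_eq not_le)
  have "depth (high_own f0) ?g (high_own f0 (f i)) (n - h)"
  proof (cases "own (f i) \<in> Some ` (I - low f0)")
    case True
    then have "high_own f0 (f i) = own (f i)" by (simp add: high_own_def)
    then show ?thesis using depth_Some.IH[OF True] by (simp only: conj_absorb)
  next
    case False
    \<comment> \<open>The truncated difference \<open>n - h\<close> is then 0, the depth of a root
      of the upper system.\<close>
    have "n \<le> h"
    proof (cases "own (f i)")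
      case None
      then show ?thesis using depth_Some by (auto simp: depth_None_iff)
    next
      case (Some j)
      then have "j \<in> low f" using False own_in[OF fi] low by auto
      then obtain m where "m \<le> h" "depth own f (Some j) m" by (auto simp: low_def)
      then show ?thesis using depth_Some.hyps Some depth_unique[of own f "Some j" n m] by simp
    qed
    then show ?thesis using False by (auto simp: high_own_def depth_Some_iff depth_None_iff)
  qed
  moreover have "?g i = f i" using i by (rule restrict_apply')
  ultimately have d: "depth (high_own f0) ?g (Some i) (Suc (n - h))" by (metis depth_Some_iff)
  have "Suc n - h = Suc (n - h)" using nh by (simp add: Suc_diff_le)
  then show ?case using nh d by (simp only: simp_thms)
qed

text \<open>Once the key is fixed, the lower part restricts the upper one through the set of
  available vertices alone; this is what makes the upper part a uniform acyclic map again.\<close>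

lemma bij_betw_cut_fiber:
  "bij_betw (\<lambda>f. restrict f (I - low f0)) {f \<in> attachments V I own. cut_key f = cut_key f0}
     (attachments (high_vertices f0) (I - low f0) (high_own f0))"
proof (rule bij_betw_byWitness[where f' = "\<lambda>g i. if i \<in> low f0 then f0 i else g i"])
  let ?A = "{f \<in> attachments V I own. cut_key f = cut_key f0}"
  let ?A' = "attachments (high_vertices f0) (I - low f0) (high_own f0)"
  let ?c = "\<lambda>g i. if i \<in> low f0 then f0 i else g i"
  show "\<forall>f\<in>?A. ?c (restrict f (I - low f0)) = f"
  proof
    fix f assume f: "f \<in> ?A"
    then have "f i = f0 i" if "i \<in> low f0" for i using low_agree[of f0 f i] that by auto
    then show "?c (restrict f (I - low f0)) = f"
      using f by (auto simp: fun_eq_iff attachments_def PiE_def extensional_def)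
  qed
  have lowI: "low f0 \<subseteq> I" by (auto simp: low_def)
  show "\<forall>g\<in>?A'. restrict (?c g) (I - low f0) = g"
    by (auto simp: attachments_def PiE_def extensional_def fun_eq_iff)
  show "(\<lambda>f. restrict f (I - low f0)) ` ?A \<subseteq> ?A'"
  proof clarify
    fix f assume f: "f \<in> attachments V I own" and key: "cut_key f = cut_key f0"
    have *: "\<exists>n. depth (high_own f0) (restrict f (I - low f0)) (Some i) n" if i: "i \<in> I - low f0" for i
    proof -
      obtain n where "depth own f (Some i) n" using f i by (auto simp: attachments_def)
      from depth_high[OF f key this] show ?thesis using i by blast
    qed
    have "f i \<in> high_vertices f0" if i: "i \<in> I - low f0" for i
    proof -
      obtain n where n: "depth own f (Some i) n" using f i by (auto simp: attachments_def)
      have "n > h" using depth_high[OF f key n] i by auto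
      moreover obtain m where "n = Suc m" "depth own f (own (f i)) m" using n by (auto simp: depth_Some_iff)
      ultimately have "m \<ge> h" "depth own f (own (f i)) m" by auto
      moreover have "f i \<in> V" using f i by (auto simp: attachments_def)
      ultimately have "f i \<in> high_vertices f" unfolding high_vertices_def by blast
      then show ?thesis using high_vertices_cong[OF f f0 key] by simp
    qed
    then show "restrict f (I - low f0) \<in> ?A'" using * by (auto simp: attachments_def)
  qed
  show "?c ` ?A' \<subseteq> ?A"
  proof clarify
    fix g assume g: "g \<in> ?A'"
    then have gP: "g \<in> (I - low f0) \<rightarrow>\<^sub>E high_vertices f0" by (auto simp: attachments_def)
    have P: "?c g \<in> I \<rightarrow>\<^sub>E V" using gP f0 lowI
      by (auto simp: attachments_def PiE_def Pi_def extensional_def high_vertices_def)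
    have hi: "\<exists>l>h. depth own (?c g) (Some i) l" if i: "i \<in> I - low f0" for i
    proof -
      obtain l where l: "depth (high_own f0) g (Some i) l" using g i by (auto simp: attachments_def)
      then have "l > 0" by (auto simp: depth_Some_iff)
      then show ?thesis using depth_glue_high[OF gP l] i by (intro exI[of _ "h + l"]) auto
    qed
    have lo: "\<exists>l\<le>h. depth own (?c g) (Some i) l" if i: "i \<in> low f0" for i
    proof -
      obtain l where l: "l \<le> h" "depth own f0 (Some i) l" "i \<in> I" using i by (auto simp: low_def)
      then have "depth own (?c g) (Some i) l" by (intro depth_low_agree[OF f0 _ l(2)]) auto
      then show ?thesis using l by auto
    qed
    have "\<exists>n. depth own (?c g) (Some i) n" if "i \<in> I" for i using hi[of i] lo[of i] that by blast
    then have A: "?c g \<in> attachments V I own" using P by (simp only: attachments_def) blast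
    have "low (?c g) = low f0"
    proof (intro set_eqI iffI)
      fix i assume "i \<in> low f0" then show "i \<in> low (?c g)" using lo[of i] lowI unfolding low_def[of "?c g"] by blast
    next
      fix i assume "i \<in> low (?c g)"
      then obtain n where "i \<in> I" "n \<le> h" "depth own (?c g) (Some i) n" unfolding low_def by blast
      then show "i \<in> low f0" using hi[of i] depth_unique by (metis DiffI not_le)
    qed
    moreover from this have "restrict (?c g) (low (?c g)) = restrict f0 (low f0)" by (auto simp: fun_eq_iff)
    ultimately have "cut_key (?c g) = cut_key f0" unfolding cut_key_def by simp
    then show "?c g \<in> attachments V I own \<and> cut_key (?c g) = cut_key f0" using A by simp
  qed
qed

end

text \<open>Bounds the expected number of vertices above the cut, vertex by vertex. Depth at least
  \<open>h\<close> means depth greater than \<open>h - 1\<close>, and \<open>h \<ge> 1\<close>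
  leaves out the roots, whose depth is 0.\<close>

lemma sum_card_high_vertices:
  assumes "h \<ge> 1"
  shows "real (\<Sum>f\<in>attachments V I own. card (high_vertices f))
     \<le> real (card V) * (real (card (attachments V I own)) * exp (- (real (h - 1) ^ 2) / (2 * real (card V))))"
proof -
  have fin: "finite V" "finite (attachments V I own)" using ps finite_attachments[OF ps] by (auto simp: petal_system_def)
  let ?A = "attachments V I own"
  have "(\<Sum>f\<in>?A. card (high_vertices f)) = (\<Sum>f\<in>?A. \<Sum>v\<in>V. if \<exists>n\<ge>h. depth own f (own v) n then 1 else 0)"
    using fin by (intro sum.cong refl) (auto simp: high_vertices_def sum.If_cases Int_def)
  also have "\<dots> = (\<Sum>v\<in>V. \<Sum>f\<in>?A. if \<exists>n\<ge>h. depth own f (own v) n then 1 else 0)" by (rule sum.swap)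
  also have "\<dots> = (\<Sum>v\<in>V. card {f\<in>?A. \<exists>n\<ge>h. depth own f (own v) n})"
    using fin by (intro sum.cong refl) (auto simp: sum.If_cases Int_def)
  finally have "real (\<Sum>f\<in>?A. card (high_vertices f)) = (\<Sum>v\<in>V. real (card {f\<in>?A. \<exists>n\<ge>h. depth own f (own v) n}))"
    by simp
  also have "\<dots> \<le> real (card V) * (real (card ?A) * exp (- (real (h - 1) ^ 2) / (2 * real (card V))))"
  proof (rule sum_bounded_above)
    fix v assume v: "v \<in> V"
    show "real (card {f\<in>?A. \<exists>n\<ge>h. depth own f (own v) n})
       \<le> real (card ?A) * exp (- (real (h - 1) ^ 2) / (2 * real (card V)))"
    proof (cases "own v")
      case None
      then have "{f\<in>?A. \<exists>n\<ge>h. depth own f (own v) n} = {}" using assms by (auto simp: depth_None_iff)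
      then show ?thesis by (simp only: card.empty) simp
    next
      case (Some i)
      then have i: "i \<in> I" using own_in[OF v] by auto
      have "h \<le> n \<longleftrightarrow> h - 1 < n" for n using assms by linarith
      then show ?thesis using card_depth_greater_exp[OF ps i, of "h - 1"] by (simp only: Some)
    qed
  qed
  finally show ?thesis .
qed

end

end

text \<open>The factor 32 makes the claim trivial unless \<open>y < 1 / 32\<close>; the 64 is chosen
  so that the tail bound at height \<open>k / 4\<close>, used for Markov's inequality, is exactly
  \<open>y ^ 2\<close>.\<close>

theorem card_tall_attachments:
  assumes "petal_system V I own"
  shows "real (card {f \<in> attachments V I own. \<exists>i\<in>I. \<exists>n\<ge>k. depth own f (Some i) n})
     \<le> 32 * exp (- (real k ^ 2) / (64 * real (card V))) * real (card (attachments V I own))"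
  using assms
proof (induction "card V" arbitrary: V I own k rule: less_induct)
  case less
  note ps = less.prems
  let ?A = "attachments V I own" and ?n = "real (card V)"
  let ?tall = "\<lambda>f. \<exists>i\<in>I. \<exists>n\<ge>k. depth own f (Some i) n"
  define y where "y = exp (- (real k ^ 2) / (64 * ?n))"
  have fin: "finite V" "finite ?A" using ps finite_attachments[OF ps] by (auto simp: petal_system_def)
  have le_all: "real (card {f\<in>?A. ?tall f}) \<le> real (card ?A)"
    using fin by (intro of_nat_mono card_mono) auto
  show ?case
  proof (cases "32 * y \<ge> 1")
    case True
    then have "1 * real (card ?A) \<le> 32 * y * real (card ?A)" by (intro mult_right_mono) auto
    then show ?thesis using le_all by (simp add: y_def)
  next
    case False
    \<comment> \<open>For empty \<open>V\<close> the division by zero gives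
      \<open>y = 1\<close>.\<close>
    have n0: "card V > 0"
    proof (rule ccontr)
      assume "\<not> card V > 0" then show False using False by (simp add: y_def)
    qed
    have y0: "y > 0" "y < 1 / 32" using False by (auto simp: y_def)
    \<comment> \<open>This ensures \<open>k div 2 - 1 \<ge> k / 4\<close>; for smaller
      \<open>k\<close> one would have \<open>y \<ge> exp (- 1)\<close>.\<close>
    have "k \<ge> 6"
    proof (rule ccontr)
      assume "\<not> k \<ge> 6"
      then have "real k ^ 2 \<le> 5 ^ 2" by (intro power_mono) auto
      then have "real k ^ 2 / (64 * ?n) \<le> 1" using n0 by (simp add: field_simps)
      then have "exp (- 1) \<le> y" unfolding y_def by simp
      moreover have "exp (- 1) \<ge> (1 / 3 :: real)" using exp_le by (simp add: exp_minus field_simps)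
      ultimately show False using y0 by simp
    qed
    define h where "h = k div 2"
    have h1: "h \<ge> 1" "h < k" using \<open>k \<ge> 6\<close> by (auto simp: h_def)
    have hk: "real (h - 1) \<ge> real k / 4" using \<open>k \<ge> 6\<close> unfolding h_def by linarith
    have hk2: "real (k - h) \<ge> real k / 2" unfolding h_def by linarith
    let ?N = "\<lambda>f. card (high_vertices V own h f)"
    let ?key = "cut_key I own h"
    \<comment> \<open>The threshold 16 turns half of the height into a gain:
      \<open>(k / 2)^2 / (64 * (n / 16)) = 4 * k^2 / (64 * n)\<close>, the exponent of
      \<open>y ^ 4\<close>.\<close>
    let ?S = "{f\<in>?A. real (?N f) \<le> ?n / 16}" and ?B = "{f\<in>?A. real (?N f) > ?n / 16}"
    have "real (card ?B) * (?n / 16) \<le> (\<Sum>f\<in>?B. real (?N f))"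
      using sum_bounded_below[of ?B "?n / 16" "\<lambda>f. real (?N f)"] by auto
    also have "\<dots> \<le> (\<Sum>f\<in>?A. real (?N f))" using fin by (intro sum_mono2) auto
    also have "\<dots> \<le> ?n * (real (card ?A) * exp (- (real (h - 1) ^ 2) / (2 * ?n)))"
      using sum_card_high_vertices[OF ps h1(1)] by simp
    also have "\<dots> \<le> ?n * (real (card ?A) * y ^ 2)"
    proof (intro mult_left_mono)
      have "(real k / 4) ^ 2 \<le> real (h - 1) ^ 2" using hk by (intro power_mono) auto
      then have "real k ^ 2 / (32 * ?n) \<le> real (h - 1) ^ 2 / (2 * ?n)"
        using n0 by (simp add: field_simps)
      moreover have "y ^ 2 = exp (- (real k ^ 2) / (32 * ?n))"
        unfolding y_def by (simp add: exp_double[symmetric] field_simps)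
      ultimately show "exp (- (real (h - 1) ^ 2) / (2 * ?n)) \<le> y ^ 2" by simp
    qed auto
    finally have B: "real (card ?B) \<le> 16 * y ^ 2 * real (card ?A)" using n0 by (simp add: field_simps)
    have S: "(\<Sum>f\<in>?S. if ?tall f then 1 else 0) \<le> (\<Sum>f\<in>?S. 32 * y ^ 4)"
    proof (rule sum_fiberwise_mono[where key = ?key])
      show "finite ?S" using fin by auto
      fix f0 assume f0: "f0 \<in> ?S"
      then have f0A: "f0 \<in> ?A" by auto
      let ?V = "high_vertices V own h f0" and ?I = "I - low I own h f0" and ?own = "high_own I own h f0"
      let ?F = "{f\<in>?A. ?key f = ?key f0}"
      have F: "{f\<in>?S. ?key f = ?key f0} = ?F"
      \<comment> \<open>The number of vertices above the cut depends on the key alone, so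
        \<open>?S\<close> is a union of whole fibres.\<close>
      proof (intro equalityI subsetI)
        fix f assume "f \<in> ?F"
        then show "f \<in> {f\<in>?S. ?key f = ?key f0}"
          using f0 high_vertices_cong[OF ps _ f0A, of f h] by simp
      qed simp
      note bij = bij_betw_cut_fiber[OF ps f0A, of h]
      note ps' = petal_system_high[OF ps f0A, of h]
      let ?T = "{g\<in>attachments ?V ?I ?own. \<exists>i\<in>?I. \<exists>n\<ge>k - h. depth ?own g (Some i) n}"
      have "card {f\<in>?F. ?tall f} \<le> card ?T"
      proof (rule card_inj_on_le[where f = "\<lambda>f. restrict f ?I"])
        show "inj_on (\<lambda>f. restrict f ?I) {f\<in>?F. ?tall f}"
          using bij by (auto simp: bij_betw_def intro: inj_on_subset)
        show "finite ?T" using finite_attachments[OF ps'] by auto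
        show "(\<lambda>f. restrict f ?I) ` {f\<in>?F. ?tall f} \<subseteq> ?T"
        proof clarify
          fix f i n assume f: "f \<in> ?A" "?key f = ?key f0" and i: "i \<in> I" "k \<le> n" "depth own f (Some i) n"
          have "restrict f ?I \<in> attachments ?V ?I ?own" using bij f by (auto simp: bij_betw_def)
          moreover have iI: "i \<in> ?I"
          proof -
            have "i \<notin> low I own h f"
            proof
              assume "i \<in> low I own h f"
              then obtain m where "m \<le> h" "depth own f (Some i) m" by (auto simp: low_def)
              then show False using depth_unique[OF i(3), of m] i(2) h1(2) by simp
            qed
            then show ?thesis using f(2) i(1) by (auto simp: cut_key_def)
          qed
          moreover have "depth ?own (restrict f ?I) (Some i) (n - h)"
            using depth_high[OF ps f0A f i(3)] iI by blast
          ultimately show "restrict f ?I \<in> attachments ?V ?I ?own \<and>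
            (\<exists>i\<in>?I. \<exists>n\<ge>k - h. depth ?own (restrict f ?I) (Some i) n)"
            using i by (metis diff_le_mono)
        qed
      qed
      also have "real (card ?T) \<le> 32 * y ^ 4 * real (card (attachments ?V ?I ?own))"
      \<comment> \<open>With no vertex above the cut, division by zero would make the exponent of
        the induction hypothesis 0 and its bound useless.\<close>
      proof (cases "?V = {}")
        case True
        then have "?I = {}" using ps' unfolding petal_system_def by auto
        then have "?T = {}" by auto
        then show ?thesis by (simp only: card.empty) simp
      next
        case False
        have N: "real (?N f0) \<le> ?n / 16" "?N f0 > 0"
          using f0 False ps' by (auto simp: card_gt_0_iff petal_system_def)
        then have "?N f0 < card V" using n0 by linarith
        from less.hyps[OF this ps', of "k - h"]
        have "real (card ?T) \<le> 32 * exp (- (real (k - h) ^ 2) / (64 * real (?N f0))) * real (card (attachments ?V ?I ?own))" .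
        also have "\<dots> \<le> 32 * y ^ 4 * real (card (attachments ?V ?I ?own))"
        proof (intro mult_right_mono mult_left_mono)
          have "(real k / 2) ^ 2 \<le> real (k - h) ^ 2" using hk2 by (intro power_mono) auto
          then have "(real k / 2) ^ 2 / (64 * (?n / 16)) \<le> real (k - h) ^ 2 / (64 * real (?N f0))"
            using N by (intro frac_le) auto
          moreover have "y ^ 4 = exp (- ((real k / 2) ^ 2 / (64 * (?n / 16))))"
            unfolding y_def by (simp add: exp_of_nat_mult[symmetric] field_simps)
          ultimately show "exp (- (real (k - h) ^ 2) / (64 * real (?N f0))) \<le> y ^ 4" by simp
        qed auto
        finally show ?thesis .
      qed
      also have "card (attachments ?V ?I ?own) = card ?F" using bij_betw_same_card[OF bij] by simp
      finally have "real (card {f\<in>?F. ?tall f}) \<le> 32 * y ^ 4 * real (card ?F)" by simp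
      moreover have "(\<Sum>f\<in>?F. if ?tall f then 1 else (0::real)) = real (card {f\<in>?F. ?tall f})"
        using fin by (auto simp: sum.If_cases Int_def)
      ultimately show "(\<Sum>f\<in>{f\<in>?S. ?key f = ?key f0}. if ?tall f then 1 else 0) \<le> (\<Sum>f\<in>{f\<in>?S. ?key f = ?key f0}. 32 * y ^ 4)"
        unfolding F by (simp add: mult.commute)
    qed
    have "card {f\<in>?A. ?tall f} \<le> card ({f\<in>?S. ?tall f} \<union> ?B)"
      using fin by (intro card_mono) auto
    also have "\<dots> \<le> card {f\<in>?S. ?tall f} + card ?B" by (rule card_Un_le)
    finally have "real (card {f\<in>?A. ?tall f}) \<le> real (card {f\<in>?S. ?tall f}) + real (card ?B)" by linarith
    also have "real (card {f\<in>?S. ?tall f}) = (\<Sum>f\<in>?S. if ?tall f then 1 else 0)"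
      using fin by (auto simp: sum.If_cases Int_def)
    also have "\<dots> \<le> real (card ?S) * (32 * y ^ 4)" using S by simp
    also have "\<dots> \<le> real (card ?A) * (32 * y ^ 4)"
      using fin by (intro mult_right_mono of_nat_mono card_mono) auto
    also have "real (card ?A) * (32 * y ^ 4) + real (card ?B) \<le> (32 * y ^ 4 + 16 * y ^ 2) * real (card ?A)"
      using B by (simp add: algebra_simps)
    also have "\<dots> \<le> 32 * y * real (card ?A)"
    proof (rule mult_right_mono)
      have "y ^ 2 \<le> y" "y ^ 4 \<le> y ^ 2" using y0 power_decreasing[of 1 2 y] power_decreasing[of 2 4 y] by auto
      moreover have "y ^ 2 \<le> y / 32" using y0 by (simp add: power2_eq_square)
      ultimately show "32 * y ^ 4 + 16 * y ^ 2 \<le> 32 * y" using y0 by linarith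
    qed simp
    finally show ?thesis by (simp add: y_def)
  qed
qed

subsection \<open>Blocks of graphs sharing at most one vertex\<close>

text \<open>Connectedness is argued with the reflexive transitive closure of this relation, which
  need not keep vertices distinct; \<open>reachable_rel_eq\<close> links it to paths.\<close>

definition adj :: "'v graph \<Rightarrow> ('v \<times> 'v) set" where
  "adj G = {(u, v). {u, v} \<in> edges G}"

lemma adj_sym: "sym (adj G)"
  by (auto simp: adj_def sym_def insert_commute)

lemma adj_rtrancl_sym: "(u, v) \<in> (adj G)\<^sup>* \<Longrightarrow> (v, u) \<in> (adj G)\<^sup>*"
  by (rule symD[OF sym_rtrancl[OF adj_sym]])

lemma adj_rtrancl_mono: "edges G \<subseteq> edges H \<Longrightarrow> (u, v) \<in> (adj G)\<^sup>* \<Longrightarrow> (u, v) \<in> (adj H)\<^sup>*"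
  by (erule rtrancl_mono[THEN subsetD, rotated]) (auto simp: adj_def)

lemma adj_verts: "is_graph G \<Longrightarrow> (u, v) \<in> adj G \<Longrightarrow> u \<in> verts G \<and> v \<in> verts G \<and> u \<noteq> v"
  by (fastforce simp: adj_def is_graph_def)

lemma graph_edgeE:
  assumes "is_graph G" "e \<in> edges G"
  obtains u v where "e = {u, v}" "u \<noteq> v" "u \<in> verts G" "v \<in> verts G" "(u, v) \<in> adj G"
  using assms by (auto simp: is_graph_def card_2_iff adj_def)

lemma path_reachable: 
  assumes "is_path G p" "i < length p"
  shows "(hd p, p ! i) \<in> (adj G)\<^sup>*"
  using assms(2)
proof (induction i)
  case 0
  then show ?case using assms(1) by (auto simp: is_path_def hd_conv_nth)
next
  case (Suc i)
  then have "(p ! i, p ! Suc i) \<in> adj G" using assms(1) by (auto simp: is_path_def adj_def)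
  then show ?case using Suc by (meson Suc_lessD rtrancl.rtrancl_into_rtrancl)
qed

lemma reachable_rel_eq:
  assumes "is_graph G"
  shows "reachable_rel G = {(u, v). u \<in> verts G \<and> (u, v) \<in> (adj G)\<^sup>*}"
proof (intro equalityI subsetI)
  fix x assume "x \<in> reachable_rel G"
  then obtain p where p: "is_path G p" "x = (hd p, last p)" by (auto simp: reachable_rel_def)
  then have "p \<noteq> []" by (simp add: is_path_def)
  then have "hd p \<in> verts G" using p(1) by (auto simp: is_path_def)
  moreover have "(hd p, last p) \<in> (adj G)\<^sup>*"
    using path_reachable[OF p(1), of "length p - 1"] \<open>p \<noteq> []\<close> by (simp add: last_conv_nth)
  ultimately show "x \<in> {(u, v). u \<in> verts G \<and> (u, v) \<in> (adj G)\<^sup>*}" using p by auto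
next
  fix x assume "x \<in> {(u, v). u \<in> verts G \<and> (u, v) \<in> (adj G)\<^sup>*}"
  then obtain u v where x: "x = (u, v)" and u: "u \<in> verts G" and r: "(u, v) \<in> (adj G)\<^sup>*" by auto
  from r have "\<exists>p. is_path G p \<and> hd p = u \<and> last p = v"
  proof induction
    case base
    show ?case using u by (intro exI[of _ "[u]"]) (auto simp: is_path_def)
  next
    case (step v w)
    then obtain p where p: "is_path G p" "hd p = u" "last p = v" by auto
    then have ne: "p \<noteq> []" by (simp add: is_path_def)
    show ?case
    proof (cases "w \<in> set p")
      \<comment> \<open>A walk that returns to the path is replaced by the prefix ending at the
        repeated vertex.\<close>
      case True
      then obtain i where i: "i < length p" "p ! i = w" by (auto simp: in_set_conv_nth)
      have "is_path G (take (Suc i) p)"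
        using p(1) i set_take_subset[of "Suc i" p] by (auto simp: is_path_def)
      moreover have "last (take (Suc i) p) = w" using i by (simp add: take_Suc_conv_app_nth)
      moreover have "hd (take (Suc i) p) = u" using p by simp
      ultimately show ?thesis by blast
    next
      case False
      have w: "w \<in> verts G" using adj_verts[OF assms step(2)] by simp
      have "is_path G (p @ [w])"
        unfolding is_path_def
      proof (intro conjI allI impI)
        show "p @ [w] \<noteq> []" "distinct (p @ [w])" "set (p @ [w]) \<subseteq> verts G"
          using False p(1) w by (auto simp: is_path_def)
        fix i assume "Suc i < length (p @ [w])"
        then consider "Suc i < length p" | "Suc i = length p" by fastforce
        then show "{(p @ [w]) ! i, (p @ [w]) ! Suc i} \<in> edges G"
        proof cases
          case 1
          then show ?thesis using p(1) by (auto simp: is_path_def nth_append)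
        next
          case 2
          then have "p ! i = v" using p(3) ne by (simp add: last_conv_nth flip: 2)
          then show ?thesis using 2 step(2) by (auto simp: nth_append adj_def)
        qed
      qed
      then show ?thesis using p ne by (intro exI[of _ "p @ [w]"]) auto
    qed
  qed
  then show "x \<in> reachable_rel G" by (auto simp: reachable_rel_def x)
qed

lemma equiv_reachable_rel:
  assumes "is_graph G"
  shows "equiv (verts G) (reachable_rel G)"
proof -
  have v: "(u, v) \<in> (adj G)\<^sup>* \<Longrightarrow> u \<in> verts G \<Longrightarrow> v \<in> verts G" for u v
    by (induction rule: rtrancl_induct) (use adj_verts[OF assms] in auto)
  show ?thesis
    unfolding reachable_rel_eq[OF assms]
    by (rule equivI) (auto simp: refl_on_def sym_def trans_def v intro: adj_rtrancl_sym)
qed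

lemma connected_graph_iff:
  assumes "is_graph G"
  shows "connected_graph G \<longleftrightarrow> verts G \<noteq> {} \<and> (\<forall>u\<in>verts G. \<forall>v\<in>verts G. (u, v) \<in> (adj G)\<^sup>*)"
proof
  note eq = equiv_reachable_rel[OF assms]
  assume "connected_graph G"
  then obtain C where C: "verts G // reachable_rel G = {C}"
    by (auto simp: connected_graph_def components_of_graph_def card_1_singleton_iff)
  then have "verts G \<noteq> {}" by auto
  moreover have "(u, v) \<in> (adj G)\<^sup>*" if "u \<in> verts G" "v \<in> verts G" for u v
  proof -
    have "reachable_rel G `` {w} = C" if "w \<in> verts G" for w
      using quotientI[OF that, of "reachable_rel G"] unfolding C by simp
    then have "reachable_rel G `` {u} = reachable_rel G `` {v}" using that by simp
    then have "(u, v) \<in> reachable_rel G" using eq_equiv_class[OF _ eq that(2)] by simp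
    then show ?thesis by (auto simp: reachable_rel_eq[OF assms])
  qed
  ultimately show "verts G \<noteq> {} \<and> (\<forall>u\<in>verts G. \<forall>v\<in>verts G. (u, v) \<in> (adj G)\<^sup>*)" by auto
next
  note eq = equiv_reachable_rel[OF assms]
  assume R: "verts G \<noteq> {} \<and> (\<forall>u\<in>verts G. \<forall>v\<in>verts G. (u, v) \<in> (adj G)\<^sup>*)"
  then obtain u where u: "u \<in> verts G" by auto
  have "verts G // reachable_rel G = {reachable_rel G `` {u}}"
  proof (intro equalityI subsetI)
    fix C assume "C \<in> verts G // reachable_rel G"
    then obtain v where v: "v \<in> verts G" "C = reachable_rel G `` {v}" by (auto elim: quotientE)
    have "(v, u) \<in> reachable_rel G" using R u v by (auto simp: reachable_rel_eq[OF assms])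
    then show "C \<in> {reachable_rel G `` {u}}" using equiv_class_eq[OF eq] v by auto
  qed (use u in \<open>auto intro: quotientI\<close>)
  then show "connected_graph G" by (simp add: connected_graph_def components_of_graph_def)
qed

section \<open>Bridges and nonseparable graphs\<close>

lemma is_graph_delete_edge: "is_graph G \<Longrightarrow> is_graph (delete_edge G e)"
  by (auto simp: is_graph_def delete_edge_def)

lemma is_graph_delete_vertex: "is_graph G \<Longrightarrow> is_graph (delete_vertex G v)"
  by (auto simp: is_graph_def delete_vertex_def)

text \<open>Saturation maps the components left after the deletion onto those of \<open>G\<close>.
  If the ends stay connected, both reachability relations coincide; if not, two components have the
  same image, so their number has grown.\<close>

lemma is_bridge_iff:
  assumes G: "is_graph G" and e: "{a, b} \<in> edges G"
  shows "is_bridge G {a, b} \<longleftrightarrow> (a, b) \<notin> (adj (delete_edge G {a, b}))\<^sup>*"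
proof -
  let ?H = "delete_edge G {a, b}"
  let ?R = "reachable_rel G" and ?S = "reachable_rel ?H"
  have H: "is_graph ?H" by (rule is_graph_delete_edge[OF G])
  have V: "verts ?H = verts G" by (simp add: delete_edge_def)
  have sub: "edges ?H \<subseteq> edges G" by (auto simp: delete_edge_def)
  have ab: "a \<in> verts G" "b \<in> verts G" using G e by (auto simp: is_graph_def)
  note R = equiv_reachable_rel[OF G] and S = equiv_reachable_rel[OF H, unfolded V]
  have SR: "?S \<subseteq> ?R" using adj_rtrancl_mono[OF sub] by (auto simp: reachable_rel_eq[OF G] reachable_rel_eq[OF H] V)
  have fin: "finite (verts G // ?S)"
    using finite_quotient[of "verts G" ?S] G by (auto simp: is_graph_def reachable_rel_eq[OF H] V quotient_def)
  show ?thesis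
  proof
    assume br: "is_bridge G {a, b}"
    show "(a, b) \<notin> (adj ?H)\<^sup>*"
    proof
      assume ab': "(a, b) \<in> (adj ?H)\<^sup>*"
      have "(adj G) \<subseteq> (adj ?H)\<^sup>*"
      proof
        fix x assume x: "x \<in> adj G"
        obtain u v where uv: "x = (u, v)" by (cases x)
        show "x \<in> (adj ?H)\<^sup>*"
        proof (cases "{u, v} = {a, b}")
          case True
          then show ?thesis using ab' adj_rtrancl_sym[OF ab'] uv by (auto simp: doubleton_eq_iff)
        next
          case False
          then show ?thesis using x uv by (auto simp: adj_def delete_edge_def)
        qed
      qed
      then have "(adj G)\<^sup>* \<subseteq> (adj ?H)\<^sup>*" by (rule rtrancl_subset_rtrancl)
      then have "?R = ?S" using SR by (auto simp: reachable_rel_eq[OF G] reachable_rel_eq[OF H] V)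
      then show False using br by (simp add: is_bridge_def components_of_graph_def V)
    qed
  next
    assume nab: "(a, b) \<notin> (adj ?H)\<^sup>*"
    have img: "verts G // ?R = (\<lambda>C. ?R `` C) ` (verts G // ?S)"
    proof -
      have "?R `` (?S `` {v}) = ?R `` {v}" if "v \<in> verts G" for v
      proof -
        have "?S `` {v} \<subseteq> ?R `` {v}" using SR by auto
        then have "?R `` (?S `` {v}) \<subseteq> ?R `` {v}" using R by (auto simp: equiv_def dest: transD)
        moreover have "v \<in> ?S `` {v}" using equiv_class_self[OF S that] .
        ultimately show ?thesis by blast
      qed
      then show ?thesis by (auto simp: quotient_def)
    qed
    have "\<not> inj_on (\<lambda>C. ?R `` C) (verts G // ?S)"
    proof
      assume inj: "inj_on (\<lambda>C. ?R `` C) (verts G // ?S)"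
      have *: "?R `` (?S `` {v}) = ?R `` {v}" if "v \<in> verts G" for v
      proof -
        have "?S `` {v} \<subseteq> ?R `` {v}" using SR by auto
        then have "?R `` (?S `` {v}) \<subseteq> ?R `` {v}" using R by (auto simp: equiv_def dest: transD)
        moreover have "v \<in> ?S `` {v}" using equiv_class_self[OF S that] .
        ultimately show ?thesis by blast
      qed
      have "(a, b) \<in> ?R" using ab e by (auto simp: reachable_rel_eq[OF G] adj_def)
      then have "?R `` {a} = ?R `` {b}" using equiv_class_eq[OF R] by auto
      then have "?S `` {a} = ?S `` {b}" using inj_onD[OF inj, of "?S `` {a}" "?S `` {b}"] * ab by (auto intro: quotientI)
      then have "(a, b) \<in> ?S" using eq_equiv_class[OF _ S] ab by metis
      then show False using nab by (simp add: reachable_rel_eq[OF H])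
    qed
    then have "card (verts G // ?R) < card (verts G // ?S)"
      unfolding img using fin card_image_le eq_card_imp_inj_on by (metis le_neq_implies_less)
    then show "is_bridge G {a, b}" using e by (simp add: is_bridge_def components_of_graph_def V)
  qed
qed

text \<open>Includes the single edge besides the 2-connected graphs, so that bridges and larger
  blocks are treated alike.\<close>

definition nonseparable :: "'v graph \<Rightarrow> bool" where
  "nonseparable G \<longleftrightarrow> is_graph G \<and> card (verts G) \<ge> 2 \<and>
     (\<forall>u\<in>verts G. \<forall>v\<in>verts G. (u, v) \<in> (adj G)\<^sup>*) \<and>
     (\<forall>z\<in>verts G. \<forall>u\<in>verts G - {z}. \<forall>v\<in>verts G - {z}. (u, v) \<in> (adj (delete_vertex G z))\<^sup>*)"

lemma two_connected_iff: "two_connected G \<longleftrightarrow> nonseparable G \<and> card (verts G) \<ge> 3"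
proof -
  have "verts G - {z} \<noteq> {}" if "card (verts G) \<ge> 3" for z
  proof
    assume "verts G - {z} = {}"
    then have "card (verts G) \<le> card {z}" by (intro card_mono) auto
    then show False using that by simp
  qed
  moreover have "verts G \<noteq> {}" if "card (verts G) \<ge> 3" using that by auto
  ultimately show ?thesis
    unfolding two_connected_def nonseparable_def
    using connected_graph_iff[of G] connected_graph_iff[OF is_graph_delete_vertex, of G]
    by (auto simp: delete_vertex_def)
qed

lemma connected_not_isolated:
  assumes "is_graph G" "\<forall>u\<in>verts G. \<forall>v\<in>verts G. (u, v) \<in> (adj G)\<^sup>*" "card (verts G) \<ge> 2"
  shows "\<not> is_isolated G v"
proof
  assume iso: "is_isolated G v"
  obtain u where u: "u \<in> verts G" "u \<noteq> v"
  proof -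
    have "\<not> verts G \<subseteq> {v}" using card_mono[of "{v}" "verts G"] assms(3) by auto
    then show ?thesis using that by auto
  qed
  then have "(v, u) \<in> (adj G)\<^sup>*" using assms(2) iso by (auto simp: is_isolated_def)
  then obtain w where "(v, w) \<in> adj G" using u(2) by (metis converse_rtranclE)
  then show False using iso by (auto simp: is_isolated_def adj_def)
qed

text \<open>A third vertex is reachable from each end of \<open>e\<close> while avoiding the other
  end, and such routes do not use \<open>e\<close>.\<close>

lemma two_connected_no_bridge:
  assumes "nonseparable G" "card (verts G) \<ge> 3"
  shows "\<not> is_bridge G e"
proof
  assume br: "is_bridge G e"
  have G: "is_graph G" using assms by (simp add: nonseparable_def)
  have "e \<in> edges G" using br by (simp add: is_bridge_def)
  then obtain a b where e: "e = {a, b}" "a \<noteq> b" "a \<in> verts G" "b \<in> verts G"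
    using graph_edgeE[OF G] by metis
  obtain c where c: "c \<in> verts G" "c \<noteq> a" "c \<noteq> b"
  proof -
    have "card {a, b} < card (verts G)" using assms(2) e by simp
    then have "\<not> verts G \<subseteq> {a, b}" using card_mono[of "{a, b}" "verts G"] by force
    then show ?thesis using that by auto
  qed
  have *: "edges (delete_vertex G a) \<subseteq> edges (delete_edge G e)" "edges (delete_vertex G b) \<subseteq> edges (delete_edge G e)"
    using e by (auto simp: delete_vertex_def delete_edge_def)
  have "(c, b) \<in> (adj (delete_vertex G a))\<^sup>*" "(a, c) \<in> (adj (delete_vertex G b))\<^sup>*"
    using assms(1) e c by (auto simp: nonseparable_def)
  then have "(a, b) \<in> (adj (delete_edge G e))\<^sup>*"
    using adj_rtrancl_mono[OF *(1)] adj_rtrancl_mono[OF *(2)] by (meson rtrancl_trans)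
  then show False using br is_bridge_iff[OF G] e \<open>e \<in> edges G\<close> by auto
qed

lemma subgraph_of_antisym: "subgraph_of G H \<Longrightarrow> subgraph_of H G \<Longrightarrow> G = H"
  by (auto simp: subgraph_of_def prod_eq_iff)

lemma blocks_nonseparable:
  assumes "nonseparable G"
  shows "blocks G = {G}"
proof -
  have G: "is_graph G" and c2: "card (verts G) \<ge> 2" using assms by (auto simp: nonseparable_def)
  have iso: "\<not> is_isolated G v" for v
    using connected_not_isolated[OF G _ c2] assms by (auto simp: nonseparable_def)
  show ?thesis
  proof (cases "card (verts G) \<ge> 3")
    case True
    then have "two_connected G" using assms by (simp add: two_connected_iff)
    moreover have "subgraph_of G G" using G by (simp add: subgraph_of_def)
    ultimately have "maximal_two_connected_in G B \<longleftrightarrow> B = G" for B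
      unfolding maximal_two_connected_in_def using subgraph_of_antisym by blast
    then show ?thesis using iso two_connected_no_bridge[OF assms True] by (auto simp: blocks_def)
  next
    case False
    then have "card (verts G) = 2" using c2 by simp
    then obtain a b where V: "verts G = {a, b}" "a \<noteq> b" by (auto simp: card_2_iff)
    have edge: "e = {a, b}" if "e \<in> edges G" for e
      using graph_edgeE[OF G that] V by (auto simp: insert_commute)
    have "\<exists>e. e \<in> edges G \<and> a \<in> e" using iso[of a] V by (auto simp: is_isolated_def)
    then have E: "edges G = {{a, b}}" using edge by auto
    have "adj (delete_edge G {a, b}) = {}" using E by (auto simp: adj_def delete_edge_def)
    then have "is_bridge G {a, b}" using is_bridge_iff[OF G, of a b] V E by auto
    then have br: "is_bridge G e \<longleftrightarrow> e = {a, b}" for e using E by (auto simp: is_bridge_def)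
    have "\<not> maximal_two_connected_in G B" for B
    proof
      assume "maximal_two_connected_in G B"
      then have "verts B \<subseteq> {a, b}" "card (verts B) \<ge> 3"
        using V by (auto simp: maximal_two_connected_in_def two_connected_def subgraph_of_def)
      then show False using card_mono[of "{a, b}" "verts B"] V(2) by simp
    qed
    moreover have "G = ({a, b}, {{a, b}})" using V E by (simp add: prod_eq_iff)
    ultimately show ?thesis using iso br by (auto simp: blocks_def)
  qed
qed

section \<open>Unions of two graphs with at most one common vertex\<close>

definition graph_union :: "'v graph \<Rightarrow> 'v graph \<Rightarrow> 'v graph" where
  "graph_union G H = (verts G \<union> verts H, edges G \<union> edges H)"

lemma graph_union_sel [simp]:
  "verts (graph_union G H) = verts G \<union> verts H" "edges (graph_union G H) = edges G \<union> edges H"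
  by (simp_all add: graph_union_def)

lemma graph_union_commute: "graph_union G H = graph_union H G"
  by (auto simp: graph_union_def)

lemma is_graph_union: "is_graph G \<Longrightarrow> is_graph H \<Longrightarrow> is_graph (graph_union G H)"
  by (auto simp: is_graph_def)

text \<open>Collapsing \<open>H\<close> to \<open>v\<close> turns walks of the union into walks of
  \<open>G\<close>, because every edge of \<open>H\<close> becomes constant.\<close>

lemma graph_union_retract:
  assumes "is_graph G" "is_graph H" "verts G \<inter> verts H \<subseteq> {v}"
    and "(a, b) \<in> (adj (graph_union G H))\<^sup>*"
  shows "(if a \<in> verts G then a else v, if b \<in> verts G then b else v) \<in> (adj G)\<^sup>*"
  using assms(4)
proof induction
  case (step b c)
  let ?r = "\<lambda>b. if b \<in> verts G then b else v"
  have "(b, c) \<in> adj G \<or> (b, c) \<in> adj H" using step(2) by (auto simp: adj_def)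
  then have "(?r b, ?r c) \<in> (adj G)\<^sup>*"
  proof
    assume "(b, c) \<in> adj G"
    then show ?thesis using adj_verts[OF assms(1)] by auto
  next
    assume "(b, c) \<in> adj H"
    then have "?r b = v" "?r c = v" using adj_verts[OF assms(2)] assms(3) by auto
    then show ?thesis by simp
  qed
  then show ?case using step.IH by (meson rtrancl_trans)
qed simp

lemma edge_not_in_both:
  assumes "is_graph G" "is_graph H" "verts G \<inter> verts H \<subseteq> {v}" "e \<in> edges G"
  shows "\<not> e \<subseteq> verts H"
proof
  assume "e \<subseteq> verts H"
  then have "e \<subseteq> {v}" "card e = 2" using assms by (auto simp: is_graph_def)
  then show False using card_mono[of "{v}" e] by simp
qed

lemma is_bridge_union:
  assumes GH: "is_graph G" "is_graph H" "verts G \<inter> verts H \<subseteq> {v}" and e: "e \<in> edges G"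
  shows "is_bridge (graph_union G H) e \<longleftrightarrow> is_bridge G e"
proof -
  obtain a b where ab: "e = {a, b}" "a \<in> verts G" "b \<in> verts G" using graph_edgeE[OF GH(1) e] by metis
  have "e \<notin> edges H" using edge_not_in_both[OF GH e] GH(2) by (auto simp: is_graph_def)
  then have del: "delete_edge (graph_union G H) e = graph_union (delete_edge G e) H"
    by (auto simp: delete_edge_def graph_union_def)
  have "(a, b) \<in> (adj (graph_union (delete_edge G e) H))\<^sup>* \<longleftrightarrow> (a, b) \<in> (adj (delete_edge G e))\<^sup>*"
  proof
    assume "(a, b) \<in> (adj (graph_union (delete_edge G e) H))\<^sup>*"
    from graph_union_retract[OF is_graph_delete_edge[OF GH(1)] GH(2) _ this] GH(3)
    show "(a, b) \<in> (adj (delete_edge G e))\<^sup>*" using ab by (auto simp: delete_edge_def)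
  qed (rule adj_rtrancl_mono, auto)
  then show ?thesis
    using is_bridge_iff[OF GH(1), of a b] is_bridge_iff[OF is_graph_union[OF GH(1,2)], of a b] e ab del by auto
qed

text \<open>Otherwise \<open>B\<close> has a vertex private to each side, and these are joined
  within \<open>B\<close> without passing through a common vertex of \<open>G\<close> and
  \<open>H\<close>; but no edge leaves the private part of \<open>G\<close> without meeting such a
  vertex.\<close>

lemma nonseparable_in_union:
  assumes GH: "is_graph G" "is_graph H" "verts G \<inter> verts H \<subseteq> {v}"
    and B: "nonseparable B" "subgraph_of B (graph_union G H)"
  shows "subgraph_of B G \<or> subgraph_of B H"
proof -
  have B': "is_graph B" using B(1) by (simp add: nonseparable_def)
  have sub: "e \<subseteq> verts B" "e \<in> edges G \<or> e \<in> edges H" if "e \<in> edges B" for e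
    using that B B' by (auto simp: subgraph_of_def is_graph_def)
  have GH': "verts H \<inter> verts G \<subseteq> {v}" using GH(3) by auto
  show ?thesis
  proof (rule ccontr)
    assume not: "\<not> ?thesis"
    have "\<not> verts B \<subseteq> verts G"
      using not sub edge_not_in_both[OF GH(2,1) GH'] B' by (fastforce simp: subgraph_of_def)
    moreover have "\<not> verts B \<subseteq> verts H"
      using not sub edge_not_in_both[OF GH] B' by (fastforce simp: subgraph_of_def)
    ultimately obtain a b where ab: "a \<in> verts B" "a \<notin> verts H" "b \<in> verts B" "b \<notin> verts G" by auto
    then have abV: "a \<in> verts G" "b \<in> verts H" using B(2) by (auto simp: subgraph_of_def)
    let ?X = "verts G \<inter> verts H"
    have "(a, b) \<in> (adj B \<inter> (- ?X) \<times> (- ?X))\<^sup>*"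
    proof (cases "v \<in> verts B \<and> v \<in> ?X")
      case True
      then have "(a, b) \<in> (adj (delete_vertex B v))\<^sup>*"
      proof -
        have "a \<in> verts B - {v}" "b \<in> verts B - {v}" using ab True by auto
        then show ?thesis using B(1) True unfolding nonseparable_def by blast
      qed
      moreover have "adj (delete_vertex B v) \<subseteq> adj B \<inter> (- ?X) \<times> (- ?X)"
        using GH(3) by (auto simp: adj_def delete_vertex_def)
      ultimately show ?thesis using rtrancl_mono by blast
    next
      case False
      have "(a, b) \<in> (adj B)\<^sup>*" using B(1) ab by (auto simp: nonseparable_def)
      moreover have "adj B \<subseteq> adj B \<inter> (- ?X) \<times> (- ?X)"
        using GH(3) False adj_verts[OF B'] by auto
      ultimately show ?thesis using rtrancl_mono by blast
    qed
    then have "b \<in> verts G - verts H"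
    proof (induction rule: rtrancl_induct)
      case base show ?case using ab abV by auto
    next
      case (step b c)
      then have "{b, c} \<in> edges G \<or> {b, c} \<in> edges H" using sub by (auto simp: adj_def)
      then show ?case using step GH(1,2) by (auto simp: is_graph_def)
    qed
    then show False using ab by simp
  qed
qed

lemma subgraph_of_trans: "subgraph_of A B \<Longrightarrow> subgraph_of B C \<Longrightarrow> subgraph_of A C"
  by (auto simp: subgraph_of_def)

lemma subgraph_of_union: "is_graph G \<Longrightarrow> subgraph_of G (graph_union G H)"
  by (auto simp: subgraph_of_def)

lemma maximal_two_connected_in_union:
  assumes GH: "is_graph G" "is_graph H" "verts G \<inter> verts H \<subseteq> {v}"
    and B: "maximal_two_connected_in G B"
  shows "maximal_two_connected_in (graph_union G H) B"
  unfolding maximal_two_connected_in_def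
proof (intro conjI allI impI)
  show "subgraph_of B (graph_union G H)" "two_connected B"
    using B subgraph_of_trans[OF _ subgraph_of_union[OF GH(1)]] by (auto simp: maximal_two_connected_in_def)
  fix C assume C: "subgraph_of C (graph_union G H) \<and> two_connected C \<and> subgraph_of B C"
  have "\<not> subgraph_of C H"
  proof
    assume "subgraph_of C H"
    then have "verts B \<subseteq> verts H" "verts B \<subseteq> verts G"
      using C B by (auto simp: subgraph_of_def maximal_two_connected_in_def)
    then have "verts B \<subseteq> {v}" using GH(3) by blast
    then have "card (verts B) \<le> 1" using card_mono[of "{v}" "verts B"] by simp
    then show False using B by (simp add: maximal_two_connected_in_def two_connected_def)
  qed
  then have "subgraph_of C G" using nonseparable_in_union[OF GH, of C] C by (auto simp: two_connected_iff)
  then show "C = B" using B C unfolding maximal_two_connected_in_def by blast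
qed

text \<open>On \<open>iso\<close>: a common vertex that is isolated in just one of the two graphs
  would be a block of that graph but not of the union.\<close>

lemma blocks_union:
  assumes GH: "is_graph G" "is_graph H" "verts G \<inter> verts H \<subseteq> {v}"
    and iso: "v \<in> verts G \<Longrightarrow> v \<in> verts H \<Longrightarrow> \<not> is_isolated G v \<and> \<not> is_isolated H v"
  shows "blocks (graph_union G H) = blocks G \<union> blocks H"
proof -
  let ?U = "graph_union G H"
  have GH': "verts H \<inter> verts G \<subseteq> {v}" using GH(3) by auto
  have mx: "maximal_two_connected_in ?U B \<longleftrightarrow> maximal_two_connected_in G B \<or> maximal_two_connected_in H B" for B
  proof
    assume B: "maximal_two_connected_in ?U B"
    then have "subgraph_of B G \<or> subgraph_of B H"
      using nonseparable_in_union[OF GH, of B] by (auto simp: two_connected_iff maximal_two_connected_in_def)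
    then show "maximal_two_connected_in G B \<or> maximal_two_connected_in H B"
      using B subgraph_of_trans[OF _ subgraph_of_union[OF GH(1), of H]]
        subgraph_of_trans[OF _ subgraph_of_union[OF GH(2), of G]]
      unfolding maximal_two_connected_in_def graph_union_commute[of H G] by blast
  next
    assume "maximal_two_connected_in G B \<or> maximal_two_connected_in H B"
    then show "maximal_two_connected_in ?U B"
      using maximal_two_connected_in_union[OF GH, of B] maximal_two_connected_in_union[OF GH(2,1) GH', of B]
      unfolding graph_union_commute[of H G] by blast
  qed
  have br: "is_bridge ?U e \<longleftrightarrow> is_bridge G e \<or> is_bridge H e" for e
    using is_bridge_union[OF GH, of e] is_bridge_union[OF GH(2,1) GH', of e]
    unfolding graph_union_commute[of H G] by (auto simp: is_bridge_def)
  have isol: "is_isolated ?U w \<longleftrightarrow> is_isolated G w \<or> is_isolated H w" for w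
  proof
    assume "is_isolated ?U w"
    then show "is_isolated G w \<or> is_isolated H w" by (auto simp: is_isolated_def)
  next
    have sub: "e \<subseteq> verts G" if "e \<in> edges G" for e using GH(1) that by (auto simp: is_graph_def)
    have sub': "e \<subseteq> verts H" if "e \<in> edges H" for e using GH(2) that by (auto simp: is_graph_def)
    assume "is_isolated G w \<or> is_isolated H w"
    then show "is_isolated ?U w"
    proof
      assume w: "is_isolated G w"
      then have "w \<in> verts G" by (simp add: is_isolated_def)
      then have "w \<notin> verts H" using iso w GH(3) by blast
      then show ?thesis using w sub' by (auto simp: is_isolated_def)
    next
      assume w: "is_isolated H w"
      then have "w \<in> verts H" by (simp add: is_isolated_def)
      then have "w \<notin> verts G" using iso w GH(3) by blast
      then show ?thesis using w sub by (auto simp: is_isolated_def)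
    qed
  qed
  show ?thesis unfolding blocks_def mx br isol by blast
qed

subsection \<open>Petals\<close>

lemma rtrancl_map:
  assumes "\<And>x y. (x, y) \<in> r \<Longrightarrow> (h x, h y) \<in> s" "(a, b) \<in> r\<^sup>*"
  shows "(h a, h b) \<in> s\<^sup>*"
  using assms(2) by induction (auto dest: assms(1))

lemma nonseparable_image:
  assumes G: "nonseparable G" and inj: "inj_on h (verts G)"
  shows "nonseparable (h ` verts G, (\<lambda>e. h ` e) ` edges G)"
proof -
  let ?H = "(h ` verts G, (\<lambda>e. h ` e) ` edges G)"
  have gr: "is_graph G" using G by (simp add: nonseparable_def)
  have sub: "e \<subseteq> verts G" "card e = 2" if "e \<in> edges G" for e using gr that by (auto simp: is_graph_def)
  have "is_graph ?H"
    using gr sub card_image[OF inj_on_subset[OF inj]] unfolding is_graph_def by auto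
  moreover have "card (verts ?H) \<ge> 2" using G card_image[OF inj] by (simp add: nonseparable_def)
  moreover have step: "(h a, h b) \<in> adj ?H" if "(a, b) \<in> adj G" for a b
    using that by (auto simp: adj_def intro!: image_eqI[of _ _ "{a, b}"])
  have "(u, v) \<in> (adj ?H)\<^sup>*" if uv: "u \<in> verts ?H" "v \<in> verts ?H" for u v
  proof -
    obtain a b where ab: "a \<in> verts G" "b \<in> verts G" "u = h a" "v = h b" using uv by auto
    have "(a, b) \<in> (adj G)\<^sup>*" using G ab by (auto simp: nonseparable_def)
    then have "(h a, h b) \<in> (adj ?H)\<^sup>*" by (rule rtrancl_map[where h = h, rotated]) (rule step)
    then show ?thesis using ab by simp
  qed
  moreover have "(u, v) \<in> (adj (delete_vertex ?H z))\<^sup>*"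
    if uvz: "z \<in> verts ?H" "u \<in> verts ?H - {z}" "v \<in> verts ?H - {z}" for u v z
  proof -
    obtain a b c where ab: "a \<in> verts G" "b \<in> verts G" "c \<in> verts G" "u = h a" "v = h b" "z = h c"
      using uvz by auto
    have "a \<in> verts G - {c}" "b \<in> verts G - {c}" using ab uvz by auto
    then have "(a, b) \<in> (adj (delete_vertex G c))\<^sup>*" using G ab(3) by (simp add: nonseparable_def)
    moreover have "(h d, h e) \<in> adj (delete_vertex ?H z)" if "(d, e) \<in> adj (delete_vertex G c)" for d e
    proof -
      have de: "{d, e} \<in> edges G" "c \<noteq> d" "c \<noteq> e" using that by (auto simp: adj_def delete_vertex_def)
      then have "h c \<noteq> h d" "h c \<noteq> h e" using inj_onD[OF inj] ab(3) sub(1)[OF de(1)] by auto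
      moreover have "{h d, h e} \<in> edges ?H" using de(1) by (auto intro!: image_eqI[of _ _ "{d, e}"])
      ultimately show ?thesis using ab by (simp add: adj_def delete_vertex_def)
    qed
    ultimately have "(h a, h b) \<in> (adj (delete_vertex ?H z))\<^sup>*" by (rule rtrancl_map[where h = h, rotated])
    then show ?thesis using ab by simp
  qed
  ultimately show ?thesis unfolding nonseparable_def by blast
qed

text \<open>The \<open>stem\<close> consists of the vertices of the rim joined to the vertex from which the petal hangs.\<close>

datatype 'v petal = Petal (rim: "'v set") (core: "'v set set") (stem: "'v set")

definition petal_graph :: "'v petal \<Rightarrow> 'v \<Rightarrow> 'v graph" where
  "petal_graph i r = (insert r (rim i), core i \<union> (\<lambda>w. {r, w}) ` stem i)"

definition petal_of :: "'v graph \<Rightarrow> 'v \<Rightarrow> 'v petal" where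
  "petal_of B r = Petal (verts B - {r}) {e \<in> edges B. r \<notin> e} {w. {r, w} \<in> edges B}"

text \<open>Quantifying over \<open>r\<close> records that the petal may be hung from any vertex
  outside its rim, whatever block it came from.\<close>

definition valid_petal :: "'v petal \<Rightarrow> bool" where
  "valid_petal i \<longleftrightarrow> rim i \<noteq> {} \<and> (\<forall>e\<in>core i. e \<subseteq> rim i) \<and> stem i \<subseteq> rim i \<and>
     (\<forall>r. r \<notin> rim i \<longrightarrow> nonseparable (petal_graph i r))"

lemma verts_petal_graph [simp]: "verts (petal_graph i r) = insert r (rim i)"
  by (simp add: petal_graph_def)

lemma petal_graph_petal_of:
  assumes "is_graph B" "r \<in> verts B"
  shows "petal_graph (petal_of B r) r = B"
proof -
  have "edges (petal_graph (petal_of B r) r) = edges B"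
  proof (intro equalityI subsetI)
    fix e assume e: "e \<in> edges B"
    show "e \<in> edges (petal_graph (petal_of B r) r)"
    proof (cases "r \<in> e")
      case True
      obtain u v where uv: "e = {u, v}" "u \<noteq> v" using graph_edgeE[OF assms(1) e] by metis
      then obtain w where "e = {r, w}" using True by (auto simp: insert_commute)
      then show ?thesis using e by (auto simp: petal_graph_def petal_of_def)
    qed (use e in \<open>auto simp: petal_graph_def petal_of_def\<close>)
  qed (auto simp: petal_graph_def petal_of_def)
  then show ?thesis using assms(2) by (auto simp: prod_eq_iff petal_of_def)
qed

lemma petal_of_petal_graph:
  assumes "valid_petal i" "r \<notin> rim i"
  shows "petal_of (petal_graph i r) r = i"
proof -
  have sub: "e \<subseteq> rim i" if "e \<in> core i" for e using assms that by (auto simp: valid_petal_def)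
  have "{e \<in> edges (petal_graph i r). r \<notin> e} = core i"
    using sub assms(2) by (auto simp: petal_graph_def)
  moreover have "{w. {r, w} \<in> edges (petal_graph i r)} = stem i"
    using sub assms by (auto simp: petal_graph_def doubleton_eq_iff valid_petal_def)
  ultimately show ?thesis using assms(2) by (cases i) (simp add: petal_of_def)
qed

text \<open>Moving the attachment vertex from \<open>r\<close> to \<open>r'\<close> is an injective
  renaming that fixes the rim, and nonseparability is invariant under such renamings.\<close>

lemma valid_petal_of:
  assumes B: "nonseparable B" and r: "r \<in> verts B"
  shows "valid_petal (petal_of B r)"
proof -
  have gr: "is_graph B" and c: "card (verts B) \<ge> 2" using B by (auto simp: nonseparable_def)
  let ?i = "petal_of B r"
  have sub: "e \<subseteq> verts B" if "e \<in> edges B" for e using gr that by (auto simp: is_graph_def)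
  have "rim ?i \<noteq> {}"
  proof
    assume "rim ?i = {}"
    then have "verts B \<subseteq> {r}" by (auto simp: petal_of_def)
    then show False using card_mono[of "{r}" "verts B"] c by simp
  qed
  moreover have in1: "\<forall>e\<in>core ?i. e \<subseteq> rim ?i" using sub by (auto simp: petal_of_def)
  moreover have st: "stem ?i \<subseteq> rim ?i"
  proof
    fix w assume "w \<in> stem ?i"
    then have "(r, w) \<in> adj B" by (simp add: petal_of_def adj_def)
    then show "w \<in> rim ?i" using adj_verts[OF gr] by (auto simp: petal_of_def)
  qed
  moreover have "nonseparable (petal_graph ?i r')" if r': "r' \<notin> rim ?i" for r'
  proof -
    let ?h = "\<lambda>v. if v = r then r' else v"
    have inj: "inj_on ?h (verts B)" using r' by (auto simp: inj_on_def petal_of_def)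
    have img: "?h ` e = e" if "r \<notin> e" for e using that by (auto simp: image_def)
    have "petal_graph ?i r' = (?h ` verts B, (\<lambda>e. ?h ` e) ` edges B)"
    proof -
      have "?h ` verts B = insert r' (rim ?i)" using r by (auto simp: petal_of_def)
      moreover have "(\<lambda>e. ?h ` e) ` edges B = edges (petal_graph ?i r')"
      proof -
        have "edges B = edges (petal_graph ?i r)" using petal_graph_petal_of[OF gr r] by simp
        also have "\<dots> = core ?i \<union> (\<lambda>w. {r, w}) ` stem ?i" by (simp add: petal_graph_def)
        finally have eB: "edges B = core ?i \<union> (\<lambda>w. {r, w}) ` stem ?i" .
        have "?h ` e = e" if "e \<in> core ?i" for e
          by (rule img) (use that in \<open>auto simp: petal_of_def\<close>)
        moreover have "?h ` {r, w} = {r', w}" if "w \<in> stem ?i" for w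
          using st that by (auto simp: petal_of_def)
        ultimately show ?thesis unfolding eB image_Un image_image petal_graph_def by simp
      qed
      ultimately show ?thesis by (simp add: petal_graph_def prod_eq_iff)
    qed
    then show ?thesis using nonseparable_image[OF B inj] by simp
  qed
  ultimately show ?thesis by (simp add: valid_petal_def)
qed

lemma petal_graph_edge:
  assumes "valid_petal i" "r \<notin> rim i" "e \<in> edges (petal_graph i r)"
  shows "e \<subseteq> insert r (rim i)" "e \<inter> rim i \<noteq> {}" "card e = 2"
proof -
  have "is_graph (petal_graph i r)" using assms by (auto simp: valid_petal_def nonseparable_def)
  then show *: "e \<subseteq> insert r (rim i)" "card e = 2" using assms(3) by (auto simp: is_graph_def)
  show "e \<inter> rim i \<noteq> {}"
  proof
    assume "e \<inter> rim i = {}"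
    then have "e \<subseteq> {r}" using * by auto
    then show False using card_mono[of "{r}" e] * by simp
  qed
qed

section \<open>Families of petals and the graphs glued from them\<close>

definition petal_family :: "'v \<Rightarrow> 'v petal set \<Rightarrow> bool" where
  "petal_family x K \<longleftrightarrow> finite K \<and> (\<forall>i\<in>K. valid_petal i \<and> x \<notin> rim i) \<and>
     (\<forall>i\<in>K. \<forall>j\<in>K. i \<noteq> j \<longrightarrow> rim i \<inter> rim j = {})"

definition ground :: "'v \<Rightarrow> 'v petal set \<Rightarrow> 'v set" where
  "ground x K = insert x (\<Union>i\<in>K. rim i)"

definition owner :: "'v petal set \<Rightarrow> 'v \<Rightarrow> 'v petal option" where
  "owner K v = (if \<exists>i\<in>K. v \<in> rim i then Some (THE i. i \<in> K \<and> v \<in> rim i) else None)"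

definition glue :: "'v \<Rightarrow> 'v petal set \<Rightarrow> ('v petal \<Rightarrow> 'v) \<Rightarrow> 'v graph" where
  "glue x K f = (ground x K, \<Union>i\<in>K. edges (petal_graph i (f i)))"

text \<open>Leaves \<open>f\<close> free outside \<open>K\<close>, so that one map serves
  subfamilies as well; \<open>attachments_decomposition\<close> adds extensionality where maps are
  counted.\<close>

definition decomposition :: "'v \<Rightarrow> 'v petal set \<Rightarrow> ('v petal \<Rightarrow> 'v) \<Rightarrow> bool" where
  "decomposition x K f \<longleftrightarrow> petal_family x K \<and> (\<forall>i\<in>K. f i \<in> ground x K) \<and>
     (\<forall>i\<in>K. \<exists>n. depth (owner K) f (Some i) n)"

lemma owner_eq_Some_iff:
  assumes "petal_family x K"
  shows "owner K v = Some i \<longleftrightarrow> i \<in> K \<and> v \<in> rim i"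
proof -
  have "(THE i. i \<in> K \<and> v \<in> rim i) = j" if "j \<in> K" "v \<in> rim j" for j
    using that assms by (intro the_equality) (auto simp: petal_family_def)
  then show ?thesis unfolding owner_def by auto
qed

lemma owner_eq_None_iff: "owner K v = None \<longleftrightarrow> (\<forall>i\<in>K. v \<notin> rim i)"
  by (simp add: owner_def)

lemma ground_owner:
  assumes "petal_family x K"
  shows "v \<in> ground x K \<longleftrightarrow> v = x \<or> owner K v \<noteq> None"
  by (auto simp: ground_def owner_eq_None_iff)

lemma owner_root: "petal_family x K \<Longrightarrow> owner K x = None"
  by (auto simp: owner_eq_None_iff petal_family_def)

lemma owner_cong:
  assumes "petal_family x K" "petal_family y L" "\<And>i. v \<in> rim i \<Longrightarrow> i \<in> K \<longleftrightarrow> i \<in> L"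
  shows "owner K v = owner L v"
proof (cases "owner K v")
  case None
  then show ?thesis using assms(3) owner_eq_None_iff by metis
next
  case (Some i)
  then show ?thesis using assms(3) owner_eq_Some_iff[OF assms(1)] owner_eq_Some_iff[OF assms(2)] by metis
qed

lemma finite_rim: "valid_petal i \<Longrightarrow> r \<notin> rim i \<Longrightarrow> finite (rim i)"
  by (auto simp: valid_petal_def nonseparable_def is_graph_def)

lemma petal_system_ground:
  assumes "petal_family x K"
  shows "petal_system (ground x K) K (owner K)"
  unfolding petal_system_def
proof (intro conjI ballI)
  have "finite (rim i)" if "i \<in> K" for i
    using assms that finite_rim[of i x] by (auto simp: petal_family_def)
  then show "finite (ground x K)" "finite K"
    using assms by (auto simp: petal_family_def ground_def)
  show "owner K v \<in> insert None (Some ` K)" for v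
    using owner_eq_Some_iff[OF assms, of v] by (cases "owner K v") auto
  fix i assume i: "i \<in> K"
  then have "rim i \<noteq> {}" using assms by (auto simp: petal_family_def valid_petal_def)
  then obtain v where "v \<in> rim i" by blast
  then show "\<exists>v\<in>ground x K. owner K v = Some i"
    using i owner_eq_Some_iff[OF assms] by (auto simp: ground_def)
qed

lemma attachments_decomposition:
  assumes "petal_family x K"
  shows "f \<in> attachments (ground x K) K (owner K) \<longleftrightarrow> decomposition x K f \<and> f \<in> extensional K"
  using assms by (auto simp: attachments_def decomposition_def PiE_def)

lemma verts_glue [simp]: "verts (glue x K f) = ground x K"
  by (simp add: glue_def)

lemma edges_glue [simp]: "edges (glue x K f) = (\<Union>i\<in>K. edges (petal_graph i (f i)))"
  by (simp add: glue_def)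

text \<open>Here \<open>i\<close> is an ancestor of \<open>a\<close>, or \<open>a\<close> itself: it
  lies on the chain from \<open>a\<close> to the roots.\<close>

inductive below :: "('v \<Rightarrow> 'i option) \<Rightarrow> ('i \<Rightarrow> 'v) \<Rightarrow> 'i \<Rightarrow> 'i option \<Rightarrow> bool"
  for own :: "'v \<Rightarrow> 'i option" and f :: "'i \<Rightarrow> 'v" and i :: 'i where
  below_refl: "below own f i (Some i)"
| below_step: "below own f i (own (f j)) \<Longrightarrow> below own f i (Some j)"

lemma below_None: "\<not> below own f i None"
  by (subst below.simps) simp

lemma below_Some_iff: "below own f i (Some j) \<longleftrightarrow> j = i \<or> below own f i (own (f j))"
  by (subst below.simps) auto

lemma below_depth:
  assumes "below own f i a" "depth own f a n" "depth own f (Some i) m"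
  shows "m \<le> n"
  using assms(1,2)
proof (induction arbitrary: n)
  case below_refl
  then show ?case using depth_unique[OF assms(3)] by simp
next
  case (below_step j)
  from below_step.prems obtain k where "n = Suc k" "depth own f (own (f j)) k"
    unfolding depth_Some_iff by blast
  then show ?case using below_step.IH[of k] by simp
qed

lemma card_below:
  assumes "depth own f a n"
  shows "finite {i. below own f i a} \<and> card {i. below own f i a} \<le> n"
  using assms
proof induction
  case depth_None
  then show ?case by (simp add: below_None)
next
  case (depth_Some j n)
  have "{i. below own f i (Some j)} = insert j {i. below own f i (own (f j))}"
    by (auto simp: below_Some_iff)
  then show ?case using depth_Some.IH 
    by (simp add: card_insert_if)
qed

section \<open>Branches of a glued graph and the vertices cutting them off\<close>

context
  fixes x :: 'v and K :: "'v petal set" and f :: "'v petal \<Rightarrow> 'v"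
  assumes dec: "decomposition x K f"
begin

abbreviation (input) part :: "'v petal \<Rightarrow> 'v graph" where
  "part i \<equiv> petal_graph i (f i)"

text \<open>These are the vertices of the component that deleting the edges of petal
  \<open>i\<close> disconnects from \<open>x\<close>.\<close>

definition branch :: "'v petal \<Rightarrow> 'v set" where
  "branch i = {v. below (owner K) f i (owner K v)}"

lemma decomposition_family: "petal_family x K"
  using dec by (simp add: decomposition_def)

lemma owner_rim: "i \<in> K \<Longrightarrow> v \<in> rim i \<Longrightarrow> owner K v = Some i"
  using owner_eq_Some_iff[OF decomposition_family] by blast

lemma decomposition_valid_petal: "i \<in> K \<Longrightarrow> valid_petal i"
  using decomposition_family by (simp add: petal_family_def)

lemma root_notin_rim:
  assumes "i \<in> K" shows "f i \<notin> rim i"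
proof
  assume "f i \<in> rim i"
  then have "owner K (f i) = Some i" using owner_eq_Some_iff[OF decomposition_family] assms by simp
  moreover obtain n where "depth (owner K) f (Some i) n" using dec assms by (auto simp: decomposition_def)
  ultimately show False using depth_not_loop by metis
qed

lemma part_nonseparable: "i \<in> K \<Longrightarrow> nonseparable (part i)"
  using decomposition_valid_petal root_notin_rim by (auto simp: valid_petal_def)

lemma part_edge:
  assumes "i \<in> K" "e \<in> edges (part i)"
  shows "e \<subseteq> insert (f i) (rim i)" "e \<inter> rim i \<noteq> {}" "card e = 2"
  using petal_graph_edge[OF decomposition_valid_petal[OF assms(1)] root_notin_rim[OF assms(1)] assms(2)] by auto

lemma root_in_ground: "i \<in> K \<Longrightarrow> f i \<in> ground x K"
  using dec by (simp add: decomposition_def)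

lemma is_graph_glue: "is_graph (glue x K f)"
  unfolding is_graph_def
proof (intro conjI ballI)
  show "finite (verts (glue x K f))"
    using petal_system_ground[OF decomposition_family] by (simp add: petal_system_def)
  fix e assume "e \<in> edges (glue x K f)"
  then obtain i where i: "i \<in> K" "e \<in> edges (part i)" by auto
  show "card e = 2" using part_edge[OF i] by simp
  show "e \<subseteq> verts (glue x K f)" using part_edge(1)[OF i] root_in_ground[OF i(1)] i(1)
    by (auto simp: ground_def)
qed

lemma rim_subset_branch: "i \<in> K \<Longrightarrow> rim i \<subseteq> branch i"
  using owner_rim by (auto simp: branch_def below_Some_iff)

lemma root_notin_branch:
  assumes "i \<in> K" shows "f i \<notin> branch i"
proof
  assume "f i \<in> branch i"
  then have b: "below (owner K) f i (owner K (f i))" by (simp add: branch_def)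
  obtain n where n: "depth (owner K) f (Some i) n" using dec assms by (auto simp: decomposition_def)
  then obtain m where m: "n = Suc m" "depth (owner K) f (owner K (f i)) m" unfolding depth_Some_iff by blast
  show False using below_depth[OF b m(2) n] m(1) by simp
qed

lemma rim_outside_branch:
  assumes "j \<in> K" "\<not> below (owner K) f i (Some j)"
  shows "insert (f j) (rim j) \<inter> branch i = {}"
  using assms owner_rim by (auto simp: branch_def below_Some_iff)

text \<open>An edge touching the branch lies in a part \<open>j\<close> having \<open>i\<close> as
  an ancestor. If \<open>j \<noteq> i\<close>, then \<open>f j\<close> is in the branch too and the
  edge cannot leave it; in the part of \<open>i\<close>, only \<open>f i\<close> is outside.\<close>

lemma branch_boundary:
  assumes i: "i \<in> K" and e: "{u, w} \<in> edges (glue x K f)" and u: "u \<in> branch i" and w: "w \<notin> branch i"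
  shows "w = f i" "{u, w} \<in> edges (part i)"
proof -
  from e obtain j where j: "j \<in> K" "{u, w} \<in> edges (part j)" by auto
  note sub = part_edge(1)[OF j]
  have b: "below (owner K) f i (Some j)"
    using rim_outside_branch[OF j(1), of i] u sub by auto
  have "j = i"
  proof (rule ccontr)
    assume "j \<noteq> i"
    then have "f j \<in> branch i" using b by (auto simp: below_Some_iff branch_def)
    moreover have "rim j \<subseteq> branch i" using b owner_rim[OF j(1)] by (auto simp: branch_def)
    ultimately show False using sub w by auto
  qed
  then show "{u, w} \<in> edges (part i)" "w = f i" using j sub w rim_subset_branch[OF i] by auto
qed

text \<open>The set \<open>S\<close> is closed under passing to the petal that one hangs from. All
  of \<open>K\<close> gives connectedness; the petals outside a branch give reachability without the
  edges of petal \<open>i\<close>.\<close>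

lemma reach_root:
  assumes S: "S \<subseteq> K" "\<And>j. j \<in> S \<Longrightarrow> owner K (f j) \<in> insert None (Some ` S)"
    and E: "\<And>j. j \<in> S \<Longrightarrow> edges (part j) \<subseteq> edges G"
    and d: "depth (owner K) f a n" and a: "a \<in> insert None (Some ` S)"
    and v: "v \<in> ground x K" "owner K v = a"
  shows "(x, v) \<in> (adj G)\<^sup>*"
  using d a v
proof (induction arbitrary: v)
  case depth_None
  then show ?case using ground_owner[OF decomposition_family] by auto
next
  case (depth_Some j n)
  then have j: "j \<in> S" "j \<in> K" using S(1) by auto
  then have "v \<in> rim j" using depth_Some owner_eq_Some_iff[OF decomposition_family] by auto
  then have "(f j, v) \<in> (adj (part j))\<^sup>*"
    using part_nonseparable[OF j(2)] by (simp add: nonseparable_def)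
  then have "(f j, v) \<in> (adj G)\<^sup>*" by (rule adj_rtrancl_mono[OF E[OF j(1)]])
  moreover have "(x, f j) \<in> (adj G)\<^sup>*"
    using depth_Some.IH[of "f j"] S(2)[OF j(1)] root_in_ground[OF j(2)] by simp
  ultimately show ?case by (rule rtrancl_trans[rotated])
qed

lemma depth_owner_ex:
  shows "\<exists>n. depth (owner K) f (owner K v) n"
proof (cases "owner K v")
  case None
  then show ?thesis by (simp add: depth_None_iff)
next
  case (Some i)
  then have "i \<in> K" using owner_eq_Some_iff[OF decomposition_family] by blast
  then show ?thesis using dec Some by (auto simp: decomposition_def)
qed

lemma owner_in: "owner K v \<in> insert None (Some ` K)"
  using owner_eq_Some_iff[OF decomposition_family, of v] by (cases "owner K v") auto

lemma glue_connected: "v \<in> ground x K \<Longrightarrow> (x, v) \<in> (adj (glue x K f))\<^sup>*"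
  using depth_owner_ex[of v] reach_root[of K "glue x K f" "owner K v" _ v] owner_in by auto

lemma reach_root_avoiding:
  assumes i: "i \<in> K" and v: "v \<in> ground x K" "v \<notin> branch i"
  shows "(x, v) \<in> (adj (ground x K, edges (glue x K f) - edges (part i)))\<^sup>*"
proof -
  let ?S = "{j\<in>K. \<not> below (owner K) f i (Some j)}"
  obtain n where n: "depth (owner K) f (owner K v) n" using depth_owner_ex by blast
  show ?thesis
  proof (rule reach_root[OF _ _ _ n _ v(1) refl])
    show "?S \<subseteq> K" by auto
    show "owner K (f j) \<in> insert None (Some ` ?S)" if "j \<in> ?S" for j
      using that owner_in[of "f j"] by (auto simp: below_Some_iff)
    show "owner K v \<in> insert None (Some ` ?S)"
      using v(2) owner_in[of v] by (auto simp: branch_def)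
    fix j assume j: "j \<in> ?S"
    show "edges (part j) \<subseteq> edges (ground x K, edges (glue x K f) - edges (part i))"
    proof
      fix e assume e: "e \<in> edges (part j)"
      have "e \<inter> branch i = {}" using part_edge(1)[OF _ e] rim_outside_branch[of j i] j by auto
      then have "e \<notin> edges (part i)" using part_edge(2)[OF i, of e] rim_subset_branch[OF i] by auto
      then show "e \<in> edges (ground x K, edges (glue x K f) - edges (part i))" using e j by auto
    qed
  qed
qed

text \<open>With \<open>reach_root_avoiding\<close>, this singles out \<open>f i\<close> as the
  vertex of the block reached from \<open>x\<close> without edges of the block, so \<open>f\<close>
  can be read off the graph.\<close>

lemma root_unique:
  assumes i: "i \<in> K" and v: "v \<in> verts (part i)"
    and r: "(x, v) \<in> (adj (ground x K, edges (glue x K f) - edges (part i)))\<^sup>*"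
  shows "v = f i"
proof -
  have "x \<notin> branch i" using owner_root[OF decomposition_family] by (simp add: branch_def below_None)
  from r this have "v \<notin> branch i"
  proof (induction rule: rtrancl_induct)
    case (step u w)
    then have e: "{w, u} \<in> edges (glue x K f)" "{w, u} \<notin> edges (part i)"
      by (auto simp: adj_def insert_commute)
    then show ?case using branch_boundary(2)[OF i e(1)] step by auto
  qed
  then show ?thesis using v rim_subset_branch[OF i] by auto
qed

end

subsection \<open>Block decomposition\<close>

lemma card_glue_ge_2:
  assumes "decomposition x K f" "K \<noteq> {}"
  shows "card (verts (glue x K f)) \<ge> 2"
proof -
  obtain i where i: "i \<in> K" using assms by blast
  have "rim i \<noteq> {}" "x \<notin> rim i"
    using decomposition_family[OF assms(1)] i by (auto simp: petal_family_def valid_petal_def)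
  then obtain v where v: "v \<in> rim i" "v \<noteq> x" by blast
  have "{x, v} \<subseteq> verts (glue x K f)" using v i by (auto simp: ground_def)
  then have "card {x, v} \<le> card (verts (glue x K f))"
    using is_graph_glue[OF assms(1)] by (intro card_mono) (auto simp: is_graph_def)
  then show ?thesis using v by simp
qed

lemma glue_connected_all:
  assumes "decomposition x K f"
  shows "\<forall>u\<in>verts (glue x K f). \<forall>v\<in>verts (glue x K f). (u, v) \<in> (adj (glue x K f))\<^sup>*"
  using glue_connected[OF assms] adj_rtrancl_sym by (metis rtrancl_trans verts_glue)

text \<open>Nothing can hang from a petal of maximal depth.\<close>

lemma leaf_petal_exists:
  assumes dec: "decomposition x K f" and ne: "K \<noteq> {}"
  shows "\<exists>i\<in>K. \<forall>j\<in>K. owner K (f j) \<noteq> Some i"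
proof -
  define d where "d i = (SOME n. depth (owner K) f (Some i) n)" for i
  have d: "depth (owner K) f (Some i) (d i)" if "i \<in> K" for i
    unfolding d_def by (rule someI_ex) (use dec that in \<open>auto simp: decomposition_def\<close>)
  have fin: "finite K" using decomposition_family[OF dec] by (simp add: petal_family_def)
  have "Max (d ` K) \<in> d ` K" using fin ne by (intro Max_in) auto
  then obtain i where i: "i \<in> K" "d i = Max (d ` K)" by (metis imageE)
  have "owner K (f j) \<noteq> Some i" if j: "j \<in> K" for j
  proof
    assume "owner K (f j) = Some i"
    moreover obtain m where m: "d j = Suc m" "depth (owner K) f (owner K (f j)) m"
      using d[OF j] unfolding depth_Some_iff by blast
    ultimately have "d i = m" using depth_unique[OF _ d[OF i(1)]] by metis
    moreover have "d j \<le> d i" using i fin j by simp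
    ultimately show False using m by simp
  qed
  then show ?thesis using i by blast
qed

lemma decomposition_remove_leaf:
  assumes dec: "decomposition x K f" and i: "i \<in> K" and leaf: "\<forall>j\<in>K. owner K (f j) \<noteq> Some i"
  shows "decomposition x (K - {i}) f"
    and "glue x K f = graph_union (glue x (K - {i}) f) (petal_graph i (f i))"
    and "ground x (K - {i}) \<inter> insert (f i) (rim i) \<subseteq> {f i}"
proof -
  let ?K = "K - {i}"
  note fam = decomposition_family[OF dec]
  have fam': "petal_family x ?K" using fam by (auto simp: petal_family_def)
  have out: "f j \<notin> rim i" if "j \<in> K" for j using owner_rim[OF dec i] leaf that by blast
  have own: "owner ?K v = owner K v" if "v \<notin> rim i" for v
    by (rule owner_cong[OF fam' fam]) (use that in auto)
  have ground: "f j \<in> ground x ?K" if j: "j \<in> K" for j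
    using root_in_ground[OF dec j] out[OF j] by (auto simp: ground_def)
  have d: "depth (owner ?K) f a n" if "depth (owner K) f a n" "a \<in> insert None (Some ` ?K)" for a n
    using that
  proof induction
    case depth_None
    show ?case by (rule depth.intros)
  next
    case (depth_Some j n)
    then have j: "j \<in> K" by auto
    have "owner K (f j) \<in> insert None (Some ` ?K)" using owner_in[OF dec, of "f j"] leaf j by auto
    then show ?case using depth_Some.IH own[OF out[OF j]] by (simp add: depth_Some_iff)
  qed
  show "decomposition x ?K f"
    unfolding decomposition_def
  proof (intro conjI ballI)
    fix j assume j: "j \<in> ?K"
    then obtain n where "depth (owner K) f (Some j) n" using dec by (auto simp: decomposition_def)
    then show "\<exists>n. depth (owner ?K) f (Some j) n" using d j by blast
  qed (use fam' ground in auto)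
  have gr: "ground x K = ground x ?K \<union> insert (f i) (rim i)"
    using i ground[OF i] by (auto simp: ground_def)
  moreover have "(\<Union>j\<in>K. edges (petal_graph j (f j))) = (\<Union>j\<in>?K. edges (petal_graph j (f j))) \<union> edges (petal_graph i (f i))"
    using i by auto
  ultimately show "glue x K f = graph_union (glue x ?K f) (petal_graph i (f i))"
    by (simp add: glue_def graph_union_def)
  have "rim j \<inter> rim i = {}" if "j \<in> ?K" for j using fam i that by (auto simp: petal_family_def)
  moreover have "x \<notin> rim i" using fam i by (auto simp: petal_family_def)
  ultimately show "ground x ?K \<inter> insert (f i) (rim i) \<subseteq> {f i}" by (auto simp: ground_def)
qed

text \<open>Leaf petals are peeled off one at a time, each meeting the rest in a single vertex. The
  empty family is excluded because the lone vertex \<open>x\<close> is then itself a block.\<close>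

theorem blocks_glue:
  assumes "decomposition x K f" "K \<noteq> {}"
  shows "blocks (glue x K f) = (\<lambda>i. petal_graph i (f i)) ` K"
  using assms
proof (induction "card K" arbitrary: K)
  case 0
  then show ?case using decomposition_family[of x K f] by (auto simp: petal_family_def)
next
  case (Suc m)
  note dec = Suc.prems(1)
  obtain i where i: "i \<in> K" and leaf: "\<forall>j\<in>K. owner K (f j) \<noteq> Some i"
    using leaf_petal_exists[OF Suc.prems] by blast
  note rem = decomposition_remove_leaf[OF dec i leaf]
  note ns = part_nonseparable[OF dec i]
  note bi = blocks_nonseparable[OF ns]
  show ?case
  proof (cases "K - {i} = {}")
    case True
    then have Ki: "K = {i}" using i by blast
    have "f i = x" using root_in_ground[OF dec i] root_notin_rim[OF dec i] unfolding Ki by (simp add: ground_def)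
    then have "glue x K f = petal_graph i (f i)" unfolding Ki by (simp add: glue_def ground_def prod_eq_iff)
    then show ?thesis using bi Ki by simp
  next
    case False
    have "finite K" using decomposition_family[OF dec] by (simp add: petal_family_def)
    then have m: "m = card (K - {i})" using Suc.hyps(2) i by simp
    have gr: "is_graph (petal_graph i (f i))" using ns by (simp add: nonseparable_def)
    note ns' = ns[unfolded nonseparable_def, THEN conjunct2]
    have "blocks (glue x K f) = blocks (glue x (K - {i}) f) \<union> blocks (petal_graph i (f i))"
      unfolding rem(2)
    proof (rule blocks_union[where v = "f i"])
      show "is_graph (glue x (K - {i}) f)" by (rule is_graph_glue[OF rem(1)])
      show "verts (glue x (K - {i}) f) \<inter> verts (petal_graph i (f i)) \<subseteq> {f i}" using rem(3) by simp
      have "\<not> is_isolated (glue x (K - {i}) f) (f i)"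
        by (rule connected_not_isolated[OF is_graph_glue[OF rem(1)] glue_connected_all[OF rem(1)] card_glue_ge_2[OF rem(1) False]])
      moreover have "\<not> is_isolated (petal_graph i (f i)) (f i)"
        by (rule connected_not_isolated[OF gr ns'[THEN conjunct2, THEN conjunct1] ns'[THEN conjunct1]])
      ultimately show "\<not> is_isolated (glue x (K - {i}) f) (f i) \<and> \<not> is_isolated (petal_graph i (f i)) (f i)" by blast
    qed (rule gr)
    also have "\<dots> = (\<lambda>i. petal_graph i (f i)) ` (K - {i}) \<union> {petal_graph i (f i)}"
      using Suc.hyps(1)[OF m rem(1) False] bi by simp
    also have "\<dots> = (\<lambda>i. petal_graph i (f i)) ` K" using i by blast
    finally show ?thesis .
  qed
qed

lemma glue_edges_empty_iff:
  assumes "decomposition x K f"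
  shows "edges (glue x K f) = {} \<longleftrightarrow> K = {}"
proof
  assume e: "edges (glue x K f) = {}"
  show "K = {}"
  proof (rule ccontr)
    assume "K \<noteq> {}"
    then have "\<not> is_isolated (glue x K f) x"
      by (intro connected_not_isolated[OF is_graph_glue[OF assms] glue_connected_all[OF assms] card_glue_ge_2[OF assms]])
    then show False using e unfolding is_isolated_def by (simp add: ground_def)
  qed
qed simp

text \<open>The blocks of the common graph are the parts, \<open>root_unique\<close> finds the
  vertex from which each hangs, and \<open>petal_of\<close> strips it off.\<close>

theorem decomposition_unique:
  assumes dec: "decomposition x K f" and dec': "decomposition x L g" and eq: "glue x K f = glue x L g"
  shows "K = L \<and> (\<forall>i\<in>K. f i = g i)"
proof -
  have *: "i \<in> L \<and> f i = g i"
    if dec: "decomposition x K f" and dec': "decomposition x L g" and eq: "glue x K f = glue x L g"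
      and i: "i \<in> K" for K L f g i
  proof -
    have ne: "K \<noteq> {}" using i by blast
    then have "edges (glue x L g) \<noteq> {}" using glue_edges_empty_iff[OF dec] unfolding eq by blast
    then have ne': "L \<noteq> {}" using glue_edges_empty_iff[OF dec'] by blast
    have "petal_graph i (f i) \<in> (\<lambda>i. petal_graph i (g i)) ` L"
      using blocks_glue[OF dec ne] blocks_glue[OF dec' ne'] i unfolding eq by blast
    then obtain j where j: "j \<in> L" "petal_graph i (f i) = petal_graph j (g j)" by blast
    have gr: "ground x K = ground x L" using eq by (metis verts_glue)
    have "(x, f i) \<in> (adj (ground x K, edges (glue x K f) - edges (petal_graph i (f i))))\<^sup>*"
      by (rule reach_root_avoiding[OF dec i root_in_ground[OF dec i] root_notin_branch[OF dec i]])
    then have "(x, f i) \<in> (adj (ground x L, edges (glue x L g) - edges (petal_graph j (g j))))\<^sup>*"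
      by (simp only: gr eq j(2))
    moreover have "f i \<in> verts (petal_graph j (g j))" unfolding j(2)[symmetric] by simp
    ultimately have fg: "f i = g j" using root_unique[OF dec' j(1)] by blast
    have "i = petal_of (petal_graph i (f i)) (f i)"
      using petal_of_petal_graph[OF decomposition_valid_petal[OF dec i] root_notin_rim[OF dec i]] by simp
    also have "\<dots> = petal_of (petal_graph j (g j)) (g j)" by (simp only: j(2)[unfolded fg] fg)
    also have "\<dots> = j" using petal_of_petal_graph[OF decomposition_valid_petal[OF dec' j(1)] root_notin_rim[OF dec' j(1)]] .
    finally show ?thesis using j(1) fg by simp
  qed
  show ?thesis using *[OF dec dec' eq] *[OF dec' dec eq[symmetric]] by blast
qed

section \<open>Existence of the decomposition\<close>

definition induced :: "'v graph \<Rightarrow> 'v set \<Rightarrow> 'v graph" where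
  "induced G U = (verts G \<inter> U, {e \<in> edges G. e \<subseteq> U})"

lemma is_graph_induced: "is_graph G \<Longrightarrow> is_graph (induced G U)"
  by (auto simp: is_graph_def induced_def)

lemma petal_family_empty: "petal_family x {}"
  by (simp add: petal_family_def)

lemma decomposition_nonseparable:
  assumes G: "nonseparable G" and x: "x \<in> verts G"
  shows "\<exists>K f. decomposition x K f \<and> glue x K f = G"
proof -
  let ?i = "petal_of G x"
  have gr: "is_graph G" using G by (simp add: nonseparable_def)
  have xi: "x \<notin> rim ?i" by (simp add: petal_of_def)
  have fam: "petal_family x {?i}"
    using valid_petal_of[OF G x] xi by (simp add: petal_family_def)
  have "owner {?i} x = None" using owner_root[OF fam] .
  then have "depth (owner {?i}) (\<lambda>_. x) (Some ?i) 1" by (simp add: depth_Some_iff depth_None_iff)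
  then have dec: "decomposition x {?i} (\<lambda>_. x)"
    using fam by (auto simp: decomposition_def ground_def)
  moreover have "glue x {?i} (\<lambda>_. x) = petal_graph ?i x"
    by (simp add: glue_def ground_def prod_eq_iff)
  ultimately show ?thesis using petal_graph_petal_of[OF gr x] by metis
qed

text \<open>The second decomposition is hung from the vertex \<open>z\<close> of the first. Its
  depths are shifted by that of the petal of \<open>z\<close>; for acyclicity it is enough that they
  exist, as \<open>d2\<close> claims.\<close>

lemma decomposition_union:
  assumes dec1: "decomposition x K1 f1" and dec2: "decomposition z K2 f2"
    and z: "z \<in> ground x K1" and disj: "ground x K1 \<inter> ground z K2 = {z}"
  shows "\<exists>K f. decomposition x K f \<and> glue x K f = graph_union (glue x K1 f1) (glue z K2 f2)"
proof -
  let ?K = "K1 \<union> K2"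
  define f where "f i = (if i \<in> K1 then f1 i else f2 i)" for i
  note fam1 = decomposition_family[OF dec1] and fam2 = decomposition_family[OF dec2]
  have r1: "rim i \<subseteq> ground x K1" "rim i \<noteq> {}" "x \<notin> rim i" if "i \<in> K1" for i
    using that fam1 by (auto simp: ground_def petal_family_def valid_petal_def)
  have r2: "rim i \<subseteq> ground z K2" "rim i \<noteq> {}" "z \<notin> rim i" if "i \<in> K2" for i
    using that fam2 by (auto simp: ground_def petal_family_def valid_petal_def)
  have r2': "rim i \<inter> ground x K1 = {}" if "i \<in> K2" for i using r2[OF that] disj by auto
  have K12: "i \<notin> K1" if "i \<in> K2" for i using r2[OF that] r2'[OF that] r1(1)[of i] by blast
  have f1: "f i = f1 i" if "i \<in> K1" for i using that by (simp add: f_def)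
  have f2: "f i = f2 i" if "i \<in> K2" for i using K12[OF that] by (simp add: f_def)
  have x1: "x \<in> ground x K1" by (simp add: ground_def)
  have fam: "petal_family x ?K"
    unfolding petal_family_def
  proof (intro conjI ballI impI)
    show "finite ?K" using fam1 fam2 by (simp add: petal_family_def)
    show "valid_petal i" if "i \<in> ?K" for i using that fam1 fam2 by (auto simp: petal_family_def)
    show "x \<notin> rim i" if "i \<in> ?K" for i using that r1(3) r2' x1 by blast
    fix i j assume ij: "i \<in> ?K" "j \<in> ?K" "i \<noteq> j"
    have "rim a \<inter> rim b = {}" if "a \<in> K1" "b \<in> K2" for a b using r1(1)[OF that(1)] r2'[OF that(2)] by blast
    then show "rim i \<inter> rim j = {}" using ij fam1 fam2 unfolding petal_family_def by blast
  qed
  have own1: "owner ?K v = owner K1 v" if v: "v \<in> ground x K1" for v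
    by (rule owner_cong[OF fam fam1]) (use r2' v in blast)
  have own2: "owner ?K v = owner K2 v" if v: "v \<in> ground z K2" "v \<noteq> z" for v
    by (rule owner_cong[OF fam fam2]) (use r1(1) v disj in blast)
  have d1: "depth (owner ?K) f a n" if "depth (owner K1) f1 a n" "a \<in> insert None (Some ` K1)" for a n
    using that
  proof induction
    case depth_None
    show ?case by (rule depth.intros)
  next
    case (depth_Some j n)
    then have j: "j \<in> K1" by auto
    have "owner ?K (f j) = owner K1 (f1 j)" using own1[OF root_in_ground[OF dec1 j]] f1[OF j] by simp
    then show ?case using depth_Some.IH owner_in[OF dec1, of "f1 j"] by (simp add: depth_Some_iff)
  qed
  have z1: "\<exists>n. depth (owner ?K) f (owner ?K v) n" if v: "v \<in> ground x K1" for v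
    using depth_owner_ex[OF dec1, of v] d1 owner_in[OF dec1, of v] own1[OF v] by metis
  have d2: "\<exists>m. depth (owner ?K) f a m" if "depth (owner K2) f2 a n" "a \<in> Some ` K2" for a n
    using that
  proof induction
    case depth_None
    then show ?case by auto
  next
    case (depth_Some j n)
    then have j: "j \<in> K2" by auto
    have g: "f2 j \<in> ground z K2" by (rule root_in_ground[OF dec2 j])
    have "\<exists>m. depth (owner ?K) f (owner ?K (f2 j)) m"
    proof (cases "f2 j = z")
      case True
      then show ?thesis using z1 z by simp
    next
      case False
      then have "owner K2 (f2 j) \<noteq> None" using g ground_owner[OF fam2] by blast
      with owner_in[OF dec2, of "f2 j"] have "owner K2 (f2 j) \<in> Some ` K2" by (metis insertE)
      then show ?thesis using depth_Some.IH own2[OF g False] by simp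
    qed
    then show ?case using f2[OF j] by (auto simp: depth_Some_iff)
  qed
  have ground: "ground x ?K = ground x K1 \<union> ground z K2"
    using z by (auto simp: ground_def)
  have "decomposition x ?K f"
    unfolding decomposition_def
  proof (intro conjI ballI)
    show "petal_family x ?K" by (rule fam)
    fix i assume i: "i \<in> ?K"
    show "f i \<in> ground x ?K"
      using i f1 f2 root_in_ground[OF dec1] root_in_ground[OF dec2] unfolding ground by (metis Un_iff)
    show "\<exists>n. depth (owner ?K) f (Some i) n"
    proof (cases "i \<in> K1")
      case True
      then obtain n where "depth (owner K1) f1 (Some i) n" using dec1 unfolding decomposition_def by blast
      then show ?thesis using d1 True by blast
    next
      case False
      then have "i \<in> K2" using i by blast
      moreover from this obtain n where "depth (owner K2) f2 (Some i) n" using dec2 unfolding decomposition_def by blast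
      ultimately show ?thesis using d2 by blast
    qed
  qed
  moreover have "glue x ?K f = graph_union (glue x K1 f1) (glue z K2 f2)"
  proof -
    have "(\<Union>i\<in>?K. edges (petal_graph i (f i))) = (\<Union>i\<in>K1. edges (petal_graph i (f1 i))) \<union> (\<Union>i\<in>K2. edges (petal_graph i (f2 i)))"
      unfolding UN_Un using f1 f2 by simp
    then show ?thesis unfolding glue_def graph_union_def ground by simp
  qed
  ultimately show ?thesis by blast
qed

text \<open>If deleting \<open>z\<close> separates \<open>G\<close>, let \<open>C\<close> be a
  component of \<open>G - z\<close> avoiding \<open>x\<close>. Then \<open>C\<close> with
  \<open>z\<close> is decomposed from the root \<open>z\<close>, the remainder from
  \<open>x\<close>, and both are smaller.\<close>

theorem decomposition_exists:
  assumes "is_graph G" "x \<in> verts G" "\<And>v. v \<in> verts G \<Longrightarrow> (x, v) \<in> (adj G)\<^sup>*"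
  shows "\<exists>K f. decomposition x K f \<and> glue x K f = G"
  using assms
proof (induction "card (verts G)" arbitrary: G x rule: less_induct)
  case less
  note gr = less.prems(1) and x = less.prems(2) and con = less.prems(3)
  have fin: "finite (verts G)" using gr by (simp add: is_graph_def)
  have conn: "(u, v) \<in> (adj G)\<^sup>*" if "u \<in> verts G" "v \<in> verts G" for u v
    using con[OF that(1)] con[OF that(2)] adj_rtrancl_sym by (metis rtrancl_trans)
  consider "card (verts G) < 2" | "nonseparable G" | "card (verts G) \<ge> 2" "\<not> nonseparable G" by linarith
  then show ?case
  proof cases
    case 1
    have "card {x} \<le> card (verts G)" using x fin by (intro card_mono) auto
    then have "card (verts G) = 1" using 1 by simp
    then have V: "verts G = {x}" using x by (auto simp: card_1_singleton_iff)
    have "edges G = {}"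
    proof (rule ccontr)
      assume "edges G \<noteq> {}"
      then obtain e where "e \<in> edges G" by blast
      then obtain u v where "u \<noteq> v" "u \<in> verts G" "v \<in> verts G" using graph_edgeE[OF gr] by metis
      then show False using V by simp
    qed
    then have "glue x {} (\<lambda>_. x) = G" using V by (simp add: glue_def ground_def prod_eq_iff)
    moreover have "decomposition x {} (\<lambda>_. x)" using petal_family_empty by (simp add: decomposition_def)
    ultimately show ?thesis by (intro exI conjI)
  next
    case 2
    then show ?thesis using x by (rule decomposition_nonseparable)
  next
    case 3
    then obtain z u v where z: "z \<in> verts G" and uv: "u \<in> verts G - {z}" "v \<in> verts G - {z}"
      and nr: "(u, v) \<notin> (adj (delete_vertex G z))\<^sup>*"
      using gr conn unfolding nonseparable_def by blast
    let ?R = "(adj (delete_vertex G z))\<^sup>*"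
    \<comment> \<open>Here \<open>c\<close> selects a component of \<open>G - z\<close> that misses
      \<open>x\<close>, and \<open>d\<close> witnesses that this component and \<open>z\<close> do
      not exhaust \<open>G\<close>, which matters when \<open>z = x\<close>.\<close>
    have "\<exists>c d. c \<in> verts G - {z} \<and> (c, x) \<notin> ?R \<and> d \<in> verts G - {z} \<and> (c, d) \<notin> ?R"
    proof (cases "(u, x) \<in> ?R")
      case True
      then have "(v, x) \<notin> ?R" using nr adj_rtrancl_sym by (metis rtrancl_trans)
      moreover have "(v, u) \<notin> ?R" using nr adj_rtrancl_sym by metis
      ultimately show ?thesis using uv by blast
    next
      case False
      then show ?thesis using uv nr by blast
    qed
    then obtain c d where c: "c \<in> verts G - {z}" "(c, x) \<notin> ?R" and d: "d \<in> verts G - {z}" "(c, d) \<notin> ?R" by blast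
    define C where "C = {w. (c, w) \<in> ?R}"
    have cC: "c \<in> C" by (simp add: C_def)
    have xC: "x \<notin> C" "d \<notin> C" using c d by (auto simp: C_def)
    have Csub: "C \<subseteq> verts G - {z}"
    proof
      fix w assume "w \<in> C"
      then have "(c, w) \<in> ?R" by (simp add: C_def)
      then show "w \<in> verts G - {z}"
      proof (induction rule: rtrancl_induct)
        case base
        show ?case using c by simp
      next
        case (step a b)
        show ?case using adj_verts[OF is_graph_delete_vertex[OF gr, of z] step(2)]
          by (simp add: delete_vertex_def)
      qed
    qed
    let ?V1 = "verts G - C" and ?V2 = "insert z C"
    let ?G1 = "induced G ?V1" and ?G2 = "induced G ?V2"
    have v1: "verts ?G1 = ?V1" and v2: "verts ?G2 = ?V2" using Csub z by (auto simp: induced_def)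
    have g1: "is_graph ?G1" and g2: "is_graph ?G2" by (rule is_graph_induced[OF gr])+
    \<comment> \<open>An edge leaving the component \<open>C\<close> of \<open>G - z\<close> can
      only end in \<open>z\<close>.\<close>
    have edge: "e \<subseteq> ?V1 \<or> e \<subseteq> ?V2" if e: "e \<in> edges G" for e
    proof -
      obtain a b where ab: "e = {a, b}" "a \<in> verts G" "b \<in> verts G" using graph_edgeE[OF gr e] by metis
      have *: "q \<in> C" if "{p, q} \<in> edges G" "p \<in> C" "q \<noteq> z" for p q
      proof -
        have "p \<noteq> z" using that Csub by blast
        then have "(p, q) \<in> adj (delete_vertex G z)" using that by (simp add: adj_def delete_vertex_def)
        then show ?thesis using that(2) unfolding C_def by (simp add: rtrancl_into_rtrancl)
      qed
      show ?thesis using *[of a b] *[of b a] e ab by (auto simp: insert_commute)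
    qed
    have G: "graph_union ?G1 ?G2 = G"
      using edge v1 v2 Csub z by (auto simp: graph_union_def prod_eq_iff induced_def)
    have int: "verts ?G1 \<inter> verts ?G2 \<subseteq> {z}" "verts ?G2 \<inter> verts ?G1 \<subseteq> {z}" using v1 v2 by auto
    have zV1: "z \<in> ?V1" using z Csub by blast
    have c1: "(x, w) \<in> (adj ?G1)\<^sup>*" if "w \<in> verts ?G1" for w
    proof -
      have "w \<in> verts G" using that v1 by blast
      then have "(x, w) \<in> (adj (graph_union ?G1 ?G2))\<^sup>*" using con G by simp
      from graph_union_retract[OF g1 g2 int(1) this] show ?thesis using that x xC v1 by simp
    qed
    have c2: "(z, w) \<in> (adj ?G2)\<^sup>*" if "w \<in> verts ?G2" for w
    proof -
      have "w \<in> verts G" using that Csub z unfolding v2 by auto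
      then have "(z, w) \<in> (adj (graph_union ?G2 ?G1))\<^sup>*" using conn[OF z] G graph_union_commute by metis
      from graph_union_retract[OF g2 g1 int(2) this] show ?thesis using that v2 by simp
    qed
    have "?V1 \<subset> verts G" using cC c by blast
    then have l1: "card (verts ?G1) < card (verts G)" unfolding v1 by (rule psubset_card_mono[OF fin])
    have "?V2 \<subset> verts G" using Csub z xC d by blast
    then have l2: "card (verts ?G2) < card (verts G)" unfolding v2 by (rule psubset_card_mono[OF fin])
    have "x \<in> verts ?G1" "z \<in> verts ?G2" using v1 v2 x xC by simp_all
    then obtain K1 f1 K2 f2 where 1: "decomposition x K1 f1" "glue x K1 f1 = ?G1"
      and 2: "decomposition z K2 f2" "glue z K2 f2 = ?G2"
      using less.hyps[OF l1 g1 _ c1] less.hyps[OF l2 g2 _ c2] by blast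
    have gr1: "ground x K1 = ?V1" and gr2: "ground z K2 = ?V2" using 1 2 v1 v2 by (metis verts_glue)+
    show ?thesis
      using decomposition_union[OF 1(1) 2(1)] gr1 gr2 zV1 1(2) 2(2) G by auto
  qed
qed

section \<open>Blocks met by a path\<close>

lemma blocks_subgraph:
  assumes "B \<in> blocks G"
  shows "edges B \<subseteq> edges G"
  using assms by (auto simp: blocks_def maximal_two_connected_in_def subgraph_of_def is_bridge_def)

lemma path_enters:
  fixes P :: "nat \<Rightarrow> bool"
  assumes "\<not> P 0" "P m"
  shows "\<exists>a<m. \<not> P a \<and> P (Suc a)"
  using assms(2)
proof (induction m)
  case 0
  then show ?case using assms(1) by simp
next
  case (Suc m)
  then show ?case by (cases "P m") (auto intro: less_SucI)
qed

lemma path_leaves: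
  fixes P :: "nat \<Rightarrow> bool"
  assumes "P m" "\<not> P l" "m \<le> l"
  shows "\<exists>a\<ge>m. a < l \<and> P a \<and> \<not> P (Suc a)"
  using assms(3,2)
proof (induction l rule: dec_induct)
  case base
  then show ?case using assms(1) by simp
next
  case (step l)
  then show ?case by (cases "P l") (auto intro: less_SucI)
qed

text \<open>The path never reaches \<open>R\<close>. The petals that it meets are ancestors of one
  of its ends, and each end has at most \<open>h\<close> of them.\<close>

theorem card_blocks_path_le:
  assumes dec: "decomposition x K f" and R: "is_graph R" "verts R \<inter> ground x K = {}"
    and p: "is_path (graph_union (glue x K f) R) p" "hd p \<in> ground x K" "length p \<ge> 2"
    and H: "\<And>i n. i \<in> K \<Longrightarrow> depth (owner K) f (Some i) n \<Longrightarrow> n \<le> h"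
  shows "card {B \<in> blocks (graph_union (glue x K f) R). passes_through p B} \<le> 2 * h"
proof -
  let ?G = "graph_union (glue x K f) R"
  have g: "is_graph (glue x K f)" by (rule is_graph_glue[OF dec])
  have pe: "{p ! k, p ! Suc k} \<in> edges ?G" if "Suc k < length p" for k
    using p(1) that by (simp add: is_path_def)
  have disj: "verts (glue x K f) \<inter> verts R = {}" using R(2) by auto
  have eg: "e \<subseteq> ground x K" if "e \<in> edges (glue x K f)" for e
    using g that by (auto simp: is_graph_def)
  have eR: "e \<subseteq> verts R" if "e \<in> edges R" for e
    using R that by (auto simp: is_graph_def)
  have ne: "p \<noteq> []" using p(3) by auto
  have inU: "p ! k \<in> ground x K" if "k < length p" for k
    using that
  proof (induction k)
    case 0
    then show ?case using p(2) ne by (simp add: hd_conv_nth)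
  next
    case (Suc k)
    then have "p ! k \<in> ground x K" by simp
    moreover have "{p ! k, p ! Suc k} \<in> edges (glue x K f) \<or> {p ! k, p ! Suc k} \<in> edges R"
      using pe[OF Suc.prems] by simp
    ultimately show ?case using eg eR R(2) by blast
  qed
  have pg: "{p ! k, p ! Suc k} \<in> edges (glue x K f)" if "Suc k < length p" for k
    using pe[OF that] eR inU[of k] that R(2) by auto
  have bl: "blocks ?G = blocks (glue x K f) \<union> blocks R"
    by (rule blocks_union[OF g R(1), of x]) (use disj in auto)
  let ?J = "{i\<in>K. path_edges p \<inter> edges (petal_graph i (f i)) \<noteq> {}}"
  let ?anc = "\<lambda>v. {i. below (owner K) f i (owner K v)}"
  have sub: "{B \<in> blocks ?G. passes_through p B} \<subseteq> (\<lambda>i. petal_graph i (f i)) ` ?J"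
  proof
    fix B assume "B \<in> {B \<in> blocks ?G. passes_through p B}"
    then have B: "B \<in> blocks (glue x K f) \<or> B \<in> blocks R" "path_edges p \<inter> edges B \<noteq> {}"
      using bl p(3) by (auto simp: passes_through_def)
    then obtain k where k: "Suc k < length p" "{p ! k, p ! Suc k} \<in> edges B" by (auto simp: path_edges_def)
    have "\<not> B \<in> blocks R"
    proof
      assume "B \<in> blocks R"
      then have "{p ! k, p ! Suc k} \<in> edges R" using blocks_subgraph k(2) by blast
      then show False using eR inU[of k] k(1) R(2) by auto
    qed
    then have Bg: "B \<in> blocks (glue x K f)" using B by blast
    have "K \<noteq> {}" using pg[OF k(1)] by auto
    then obtain i where "i \<in> K" "B = petal_graph i (f i)" using Bg blocks_glue[OF dec] by blast
    then show "B \<in> (\<lambda>i. petal_graph i (f i)) ` ?J" using B(2) by blast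
  qed
  have J: "?J \<subseteq> ?anc (hd p) \<union> ?anc (last p)"
  proof
    fix i assume i': "i \<in> ?J"
    then have i: "i \<in> K" by simp
    obtain k where k: "Suc k < length p" "{p ! k, p ! Suc k} \<in> edges (petal_graph i (f i))"
      using i' by (auto simp: path_edges_def)
    let ?P = "\<lambda>k. p ! k \<in> branch K f i"
    have "p ! k \<in> rim i \<or> p ! Suc k \<in> rim i" using part_edge(2)[OF dec i k(2)] by blast
    then obtain m where m: "m < length p" "?P m"
      using rim_subset_branch[OF dec i] k(1) by (metis Suc_lessD subsetD)
    \<comment> \<open>Otherwise the path enters and later leaves the branch, visiting
      \<open>f i\<close> both times.\<close>
    have "hd p \<in> branch K f i \<or> last p \<in> branch K f i"
    proof (rule ccontr)
      assume "\<not> ?thesis"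
      then have not: "\<not> ?P 0" "\<not> ?P (length p - 1)" using ne by (simp_all add: hd_conv_nth last_conv_nth)
      obtain a where a: "a < m" "\<not> ?P a" "?P (Suc a)" using path_enters[of ?P m] not m by blast
      have "m \<le> length p - 1" using m by linarith
      then obtain b where b: "b \<ge> m" "b < length p - 1" "?P b" "\<not> ?P (Suc b)"
        using path_leaves[of ?P m "length p - 1"] not m by blast
      have "{p ! Suc a, p ! a} \<in> edges (glue x K f)" using pg[of a] a m by (simp add: insert_commute)
      then have "p ! a = f i" using branch_boundary(1)[OF dec i] a by blast
      moreover have "{p ! b, p ! Suc b} \<in> edges (glue x K f)" using pg[of b] b by simp
      then have "p ! Suc b = f i" using branch_boundary(1)[OF dec i] b by blast
      ultimately have "p ! a = p ! Suc b" by simp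
      moreover have "a < length p" "Suc b < length p" using a b m by linarith+
      moreover have "distinct p" using p(1) by (simp add: is_path_def)
      ultimately have "a = Suc b" by (simp add: nth_eq_iff_index_eq)
      then show False using a b by simp
    qed
    then show "i \<in> ?anc (hd p) \<union> ?anc (last p)" by (simp add: branch_def[OF dec])
  qed
  have anc: "finite (?anc v) \<and> card (?anc v) \<le> h" for v
  proof -
    obtain n where n: "depth (owner K) f (owner K v) n" using depth_owner_ex[OF dec] by blast
    have "n \<le> h"
    proof (cases "owner K v")
      case None
      then show ?thesis using n by (simp add: depth_None_iff)
    next
      case (Some i)
      then have "i \<in> K" using owner_eq_Some_iff[OF decomposition_family[OF dec]] by blast
      then show ?thesis using H n Some by simp
    qed
    then show ?thesis using card_below[OF n] by linarith
  qed
  have finJ: "finite ?J" using finite_subset[OF J] anc by blast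
  have "card {B \<in> blocks ?G. passes_through p B} \<le> card ((\<lambda>i. petal_graph i (f i)) ` ?J)"
    by (rule card_mono[OF finite_imageI[OF finJ] sub])
  also have "\<dots> \<le> card ?J" by (rule card_image_le[OF finJ])
  also have "\<dots> \<le> card (?anc (hd p) \<union> ?anc (last p))" using anc by (intro card_mono[OF _ J]) blast
  also have "\<dots> \<le> card (?anc (hd p)) + card (?anc (last p))" by (rule card_Un_le)
  also have "\<dots> \<le> 2 * h" using anc[of "hd p"] anc[of "last p"] by linarith
  finally show ?thesis .
qed

subsection \<open>Random members of a block-stable class\<close>

definition component :: "'v graph \<Rightarrow> 'v \<Rightarrow> 'v set" where
  "component G x = {v. (x, v) \<in> (adj G)\<^sup>*}"

lemma component_subset:
  assumes "is_graph G" "x \<in> verts G"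
  shows "component G x \<subseteq> verts G"
proof
  fix v assume "v \<in> component G x"
  then have "(x, v) \<in> (adj G)\<^sup>*" by (simp add: component_def)
  then show "v \<in> verts G"
  proof (induction rule: rtrancl_induct)
    case base
    show ?case by (rule assms(2))
  next
    case (step a b)
    show ?case using adj_verts[OF assms(1) step(2)] by simp
  qed
qed

lemma component_self: "x \<in> component G x"
  by (simp add: component_def)

lemma component_eq: "y \<in> component G x \<Longrightarrow> component G y = component G x"
  unfolding component_def using adj_rtrancl_sym rtrancl_trans by (metis mem_Collect_eq)

lemma component_split:
  assumes G: "is_graph G" and x: "x \<in> verts G"
  shows "graph_union (induced G (component G x)) (induced G (verts G - component G x)) = G"
proof -
  let ?U = "component G x"
  have "e \<subseteq> ?U \<or> e \<subseteq> verts G - ?U" if e: "e \<in> edges G" for e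
  proof -
    obtain a b where ab: "e = {a, b}" "a \<in> verts G" "b \<in> verts G" "(a, b) \<in> adj G"
      using graph_edgeE[OF G e] by metis
    then have "(b, a) \<in> adj G" by (simp add: adj_def insert_commute)
    then have "a \<in> ?U \<longleftrightarrow> b \<in> ?U" using ab(4) unfolding component_def
      by (metis mem_Collect_eq rtrancl.rtrancl_into_rtrancl)
    then show ?thesis using ab by auto
  qed
  then show ?thesis by (auto simp: graph_union_def prod_eq_iff induced_def)
qed

lemma component_induced_connected:
  assumes G: "is_graph G" and x: "x \<in> verts G" and v: "v \<in> component G x"
  shows "(x, v) \<in> (adj (induced G (component G x)))\<^sup>*"
proof -
  let ?U = "component G x"
  let ?A = "induced G ?U" and ?B = "induced G (verts G - ?U)"
  have "(x, v) \<in> (adj (graph_union ?A ?B))\<^sup>*"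
    unfolding component_split[OF G x] using v by (simp add: component_def)
  moreover have "verts ?A \<inter> verts ?B \<subseteq> {x}" by (auto simp: induced_def)
  moreover have "v \<in> verts ?A" using v component_subset[OF G x] by (auto simp: induced_def)
  ultimately show ?thesis
    using graph_union_retract[OF is_graph_induced[OF G] is_graph_induced[OF G], of ?U "verts G - ?U" x x v]
    by (simp only: if_cancel if_True)
qed

lemma graph_edge_subset:
  assumes "is_graph G" "e \<in> edges G"
  shows "e \<subseteq> verts G" "e \<noteq> {}"
proof -
  have "card e = 2" using assms by (simp add: is_graph_def)
  then show "e \<noteq> {}" by auto
  show "e \<subseteq> verts G" using assms by (simp add: is_graph_def)
qed

lemma component_glue_union:
  assumes dec: "decomposition x K f" and R: "is_graph R" "verts R \<inter> ground x K = {}"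
  shows "component (graph_union (glue x K f) R) x = ground x K"
    and "induced (graph_union (glue x K f) R) (ground x K) = glue x K f"
    and "induced (graph_union (glue x K f) R) (verts (graph_union (glue x K f) R) - ground x K) = R"
proof -
  let ?G = "graph_union (glue x K f) R"
  have g: "is_graph (glue x K f)" by (rule is_graph_glue[OF dec])
  note eg = graph_edge_subset[OF g, unfolded verts_glue] and eR = graph_edge_subset[OF R(1)]
  have x: "x \<in> ground x K" by (simp add: ground_def)
  show "component ?G x = ground x K"
  proof (intro equalityI subsetI)
    fix v assume "v \<in> ground x K"
    then have "(x, v) \<in> (adj ?G)\<^sup>*"
      by (intro adj_rtrancl_mono[OF _ glue_connected[OF dec]]) auto
    then show "v \<in> component ?G x" by (simp add: component_def)
  next
    fix v assume "v \<in> component ?G x"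
    then have "(x, v) \<in> (adj ?G)\<^sup>*" by (simp add: component_def)
    then show "v \<in> ground x K"
    proof (induction rule: rtrancl_induct)
      case (step u w)
      then have "{u, w} \<in> edges (glue x K f) \<or> {u, w} \<in> edges R" by (simp add: adj_def)
      then show ?case using eg(1) eR(1) R(2) step.IH by blast
    qed (rule x)
  qed
  show "induced ?G (ground x K) = glue x K f"
    using eg(1) eR R(2) by (fastforce simp: induced_def prod_eq_iff glue_def)
  have "verts ?G - ground x K = verts R" using R(2) by auto
  then show "induced ?G (verts ?G - ground x K) = R"
    using eg eR(1) R(2) by (fastforce simp: induced_def prod_eq_iff)
qed

text \<open>The choice is harmless, since \<open>decomposition_unique\<close> leaves only one such
  family.\<close>

definition petals_of :: "'v graph \<Rightarrow> 'v \<Rightarrow> 'v petal set" where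
  "petals_of G x = (SOME K. \<exists>f. decomposition x K f \<and> glue x K f = induced G (component G x))"

lemma petals_of:
  assumes G: "is_graph G" and x: "x \<in> verts G"
  shows "\<exists>f. decomposition x (petals_of G x) f \<and> glue x (petals_of G x) f = induced G (component G x)"
proof -
  let ?A = "induced G (component G x)"
  have "verts ?A = component G x" using component_subset[OF assms] by (auto simp: induced_def)
  then have "\<exists>K f. decomposition x K f \<and> glue x K f = ?A"
    using component_self[of x G] component_induced_connected[OF assms]
    by (intro decomposition_exists[OF is_graph_induced[OF G]]) auto
  then show ?thesis unfolding petals_of_def by (rule someI_ex)
qed

text \<open>Together with \<open>petals_of\<close> this forms the key on which the random graph is
  conditioned.\<close>

definition rest :: "'v graph \<Rightarrow> 'v \<Rightarrow> 'v graph" where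
  "rest G x = induced G (verts G - component G x)"

lemma petals_of_glue_union:
  assumes dec: "decomposition x K f" and R: "is_graph R" "verts R \<inter> ground x K = {}"
  shows "petals_of (graph_union (glue x K f) R) x = K" "rest (graph_union (glue x K f) R) x = R"
proof -
  let ?G = "graph_union (glue x K f) R"
  note c = component_glue_union[OF dec R]
  show "rest ?G x = R" by (simp only: rest_def c(1) c(3))
  have gG: "is_graph ?G" using is_graph_union[OF is_graph_glue[OF dec] R(1)] .
  have xG: "x \<in> verts ?G" by (simp add: ground_def)
  obtain g where g: "decomposition x (petals_of ?G x) g"
    "glue x (petals_of ?G x) g = induced ?G (component ?G x)"
    using petals_of[OF gG xG] by (elim exE conjE)
  show "petals_of ?G x = K"
    by (rule decomposition_unique[OF g(1) dec g(2)[unfolded c(1) c(2)], THEN conjunct1])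
qed

lemma decomposition_restrict:
  assumes dec: "decomposition x K f"
  shows "decomposition x K (restrict f K)" "glue x K (restrict f K) = glue x K f"
proof -
  show "glue x K (restrict f K) = glue x K f" by (simp add: glue_def)
  have d: "depth (owner K) (restrict f K) a n" if "depth (owner K) f a n" "a \<in> insert None (Some ` K)" for a n
    by (rule depth_cong_own[OF _ _ that]) (use owner_in[OF dec] in auto)
  show "decomposition x K (restrict f K)"
    unfolding decomposition_def
  proof (intro conjI ballI)
    show "petal_family x K" by (rule decomposition_family[OF dec])
    fix i assume i: "i \<in> K"
    then show "restrict f K i \<in> ground x K" using root_in_ground[OF dec] by simp
    obtain n where "depth (owner K) f (Some i) n" using dec i unfolding decomposition_def by blast
    then show "\<exists>n. depth (owner K) (restrict f K) (Some i) n" using d i by blast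
  qed
qed

text \<open>Rehanging a petal replaces a block by an isomorphic one, which is where closure under
  isomorphism enters.\<close>

lemma petal_graph_iso:
  assumes i: "valid_petal i" and r: "r \<notin> rim i" "r' \<notin> rim i"
  shows "graph_iso (petal_graph i r) (petal_graph i r')"
proof -
  have swap: "{if u = r then r' else u, if v = r then r' else v} \<in> edges (petal_graph i r')"
    if e: "{u, v} \<in> edges (petal_graph i r)" and ri: "r \<notin> rim i" for r r' u v
  proof -
    consider "{u, v} \<in> core i" | w where "w \<in> stem i" "{u, v} = {r, w}"
      using e by (auto simp: petal_graph_def)
    then show ?thesis
    proof cases
      case 1
      then have "u \<in> rim i" "v \<in> rim i" using i by (auto simp: valid_petal_def)
      then have "u \<noteq> r" "v \<noteq> r" using ri by auto
      then show ?thesis using 1 by (simp add: petal_graph_def)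
    next
      case 2
      then have "w \<noteq> r" using i ri 2(1) by (auto simp: valid_petal_def)
      then have "{if u = r then r' else u, if v = r then r' else v} = {r', w}"
        using 2(2) by (auto simp: doubleton_eq_iff)
      then show ?thesis using 2(1) by (simp add: petal_graph_def)
    qed
  qed
  let ?h = "\<lambda>v. if v = r then r' else v"
  have "bij_betw ?h (insert r (rim i)) (insert r' (rim i))"
    by (rule bij_betw_byWitness[where f' = "\<lambda>v. if v = r' then r else v"]) (use r in auto)
  moreover have "{u, v} \<in> edges (petal_graph i r) \<longleftrightarrow> {?h u, ?h v} \<in> edges (petal_graph i r')"
    if "u \<in> insert r (rim i)" "v \<in> insert r (rim i)" for u v
  proof
    assume "{u, v} \<in> edges (petal_graph i r)"
    then show "{?h u, ?h v} \<in> edges (petal_graph i r')" using swap r by blast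
  next
    assume "{?h u, ?h v} \<in> edges (petal_graph i r')"
    from swap[OF this r(2), of r]
    have "{if ?h u = r' then r else ?h u, if ?h v = r' then r else ?h v} \<in> edges (petal_graph i r)" .
    moreover have "(if ?h u = r' then r else ?h u) = u" "(if ?h v = r' then r else ?h v) = v"
      using that r by auto
    ultimately show "{u, v} \<in> edges (petal_graph i r)" by (simp only:)
  qed
  ultimately show ?thesis unfolding graph_iso_def verts_petal_graph by blast
qed

lemma members_on_iff: "G \<in> members_on \<A> n \<longleftrightarrow> G \<in> \<A> \<and> verts G = {1..n}"
  by (simp add: members_on_def)

text \<open>Any rehanging of the petals keeps the blocks of \<open>R\<close> and replaces the others
  by isomorphic copies, so by block-stability it stays in the class. Conversely a graph with the
  same key differs only in its attachment map.\<close>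

lemma bij_betw_fiber:
  assumes \<A>: "graph_class \<A>" "block_stable \<A>"
    and G0: "G0 \<in> members_on \<A> n" and x: "x \<in> {1..n}"
  defines "K \<equiv> petals_of G0 x" and "R \<equiv> rest G0 x"
  shows "bij_betw (\<lambda>f. graph_union (glue x K f) R) (attachments (ground x K) K (owner K))
    {G \<in> members_on \<A> n. petals_of G x = K \<and> rest G x = R}"
    and "is_graph R" "verts R \<inter> ground x K = {}" "petal_family x K" "ground x K = component G0 x"
proof -
  have g0: "is_graph G0" and G0A: "G0 \<in> \<A>" and v0: "verts G0 = {1..n}"
    using G0 \<A>(1) by (auto simp: members_on_iff graph_class_def)
  have x0: "x \<in> verts G0" using x v0 by simp
  obtain f0 where dec0: "decomposition x K f0" and eq0: "glue x K f0 = induced G0 (component G0 x)"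
    using petals_of[OF g0 x0] unfolding K_def by blast
  show fam: "petal_family x K" by (rule decomposition_family[OF dec0])
  have "ground x K = verts G0 \<inter> component G0 x"
    using arg_cong[OF eq0, of verts] by (simp add: induced_def)
  then show gr: "ground x K = component G0 x" using component_subset[OF g0 x0] by auto
  show R: "is_graph R" unfolding R_def rest_def by (rule is_graph_induced[OF g0])
  show disj: "verts R \<inter> ground x K = {}" unfolding gr by (auto simp: R_def rest_def induced_def)
  have G0eq: "G0 = graph_union (glue x K f0) R"
    unfolding eq0 R_def rest_def by (rule component_split[OF g0 x0, symmetric])
  have bl: "blocks (graph_union (glue x K f) R) = blocks (glue x K f) \<union> blocks R" if "decomposition x K f" for f
    by (rule blocks_union[OF is_graph_glue[OF that] R, of x]) (use disj in auto)
  have stable: "G \<in> \<A> \<longleftrightarrow> blocks G \<subseteq> \<A>" if "is_graph G" for G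
    using \<A>(2) that unfolding block_stable_def by blast
  have inA: "graph_union (glue x K f) R \<in> \<A>" if dec: "decomposition x K f" for f
  \<comment> \<open>Without petals the component is the vertex \<open>x\<close> alone, which
    \<open>blocks_glue\<close> does not cover; but then \<open>f\<close> has no influence and the
    graph is \<open>G0\<close>.\<close>
  proof (cases "K = {}")
    case True
    then have "glue x K f = glue x K f0" by (simp add: glue_def)
    then show ?thesis using G0eq G0A by simp
  next
    case False
    have b0: "blocks G0 \<subseteq> \<A>" using stable[OF g0] G0A by simp
    have "petal_graph i (f i) \<in> \<A>" if i: "i \<in> K" for i
    proof -
      have "petal_graph i (f0 i) \<in> blocks G0"
        using blocks_glue[OF dec0 False] bl[OF dec0] G0eq i by blast
      then have "petal_graph i (f0 i) \<in> \<A>" using b0 by blast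
      moreover have "graph_iso (petal_graph i (f0 i)) (petal_graph i (f i))"
        by (rule petal_graph_iso[OF decomposition_valid_petal[OF dec i] root_notin_rim[OF dec0 i] root_notin_rim[OF dec i]])
      moreover have "is_graph (petal_graph i (f i))"
        using part_nonseparable[OF dec i] by (simp add: nonseparable_def)
      ultimately show ?thesis using \<A>(1) unfolding graph_class_def by blast
    qed
    moreover have "blocks R \<subseteq> \<A>" using b0 bl[OF dec0] G0eq by blast
    ultimately have "blocks (graph_union (glue x K f) R) \<subseteq> \<A>"
      unfolding bl[OF dec] blocks_glue[OF dec False] by auto
    then show ?thesis using stable is_graph_union[OF is_graph_glue[OF dec] R] by blast
  qed
  let ?A = "attachments (ground x K) K (owner K)"
  have att: "decomposition x K f" if "f \<in> ?A" for f
    using that attachments_decomposition[OF fam] by blast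
  show "bij_betw (\<lambda>f. graph_union (glue x K f) R) ?A {G \<in> members_on \<A> n. petals_of G x = K \<and> rest G x = R}"
    unfolding bij_betw_def
  proof
    show "inj_on (\<lambda>f. graph_union (glue x K f) R) ?A"
    proof (rule inj_onI)
      fix f g assume f: "f \<in> ?A" and g: "g \<in> ?A" and eq: "graph_union (glue x K f) R = graph_union (glue x K g) R"
      have "glue x K f = induced (graph_union (glue x K f) R) (ground x K)"
        by (rule component_glue_union(2)[OF att[OF f] R disj, symmetric])
      also have "\<dots> = glue x K g"
        unfolding eq by (rule component_glue_union(2)[OF att[OF g] R disj])
      finally have "\<forall>i\<in>K. f i = g i"
        by (rule decomposition_unique[OF att[OF f] att[OF g], THEN conjunct2])
      moreover have "f \<in> extensional K" "g \<in> extensional K"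
        using f g by (simp_all add: attachments_decomposition[OF fam])
      ultimately show "f = g" by (intro extensionalityI[of f K g]) simp_all
    qed
    show "(\<lambda>f. graph_union (glue x K f) R) ` ?A = {G \<in> members_on \<A> n. petals_of G x = K \<and> rest G x = R}"
    proof (intro equalityI subsetI)
      fix G assume "G \<in> (\<lambda>f. graph_union (glue x K f) R) ` ?A"
      then obtain f where f: "f \<in> ?A" and G: "G = graph_union (glue x K f) R" by blast
      have "verts G = {1..n}" using arg_cong[OF G0eq, of verts] v0 unfolding G by simp
      then show "G \<in> {G \<in> members_on \<A> n. petals_of G x = K \<and> rest G x = R}"
        using inA[OF att[OF f]] petals_of_glue_union[OF att[OF f] R disj] unfolding G members_on_iff by blast
    next
      fix G assume "G \<in> {G \<in> members_on \<A> n. petals_of G x = K \<and> rest G x = R}"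
      then have "G \<in> \<A>" "verts G = {1..n}" and KR: "petals_of G x = K" "rest G x = R"
        by (auto simp: members_on_iff)
      then have g: "is_graph G" "x \<in> verts G" using \<A>(1) x by (auto simp: graph_class_def)
      obtain f where f: "decomposition x K f" "glue x K f = induced G (component G x)"
        using petals_of[OF g] KR by blast
      have "graph_union (glue x K f) R = G"
        unfolding f(2) KR(2)[symmetric] rest_def by (rule component_split[OF g])
      then have "G = graph_union (glue x K (restrict f K)) R" using decomposition_restrict(2)[OF f(1)] by simp
      moreover have "restrict f K \<in> ?A"
        using attachments_decomposition[OF fam] decomposition_restrict(1)[OF f(1)] by simp
      ultimately show "G \<in> (\<lambda>f. graph_union (glue x K f) R) ` ?A" by blast
    qed
  qed
qed

text \<open>Asking for a start in the component of \<open>x\<close>, not at \<open>x\<close>, makes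
  the property common to all vertices of the component, as the weights require.\<close>

definition long_path_from :: "real \<Rightarrow> 'v graph \<Rightarrow> 'v \<Rightarrow> bool" where
  "long_path_from s G x \<longleftrightarrow> (\<exists>p. is_path G p \<and> hd p \<in> component G x \<and> length p \<ge> 2 \<and>
     s \<le> real (card {B \<in> blocks G. passes_through p B}))"

lemma card_long_path_fiber:
  assumes \<A>: "graph_class \<A>" "block_stable \<A>"
    and G0: "G0 \<in> members_on \<A> n" and x: "x \<in> {1..n}" and s: "s > 0"
  defines "F \<equiv> {G \<in> members_on \<A> n. petals_of G x = petals_of G0 x \<and> rest G x = rest G0 x}"
  shows "real (card {G \<in> F. long_path_from s G x})
    \<le> 32 * exp (- (s ^ 2) / (256 * real (card (component G0 x)))) * real (card F)"
proof -
  let ?K = "petals_of G0 x" and ?R = "rest G0 x"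
  let ?A = "attachments (ground x ?K) ?K (owner ?K)"
  let ?g = "\<lambda>f. graph_union (glue x ?K f) ?R"
  note fib = bij_betw_fiber[OF \<A> G0 x]
  note ps = petal_system_ground[OF fib(4)]
  \<comment> \<open>The least natural number with \<open>2 * k \<ge> s\<close>: since
    \<open>2 * (k - 1) < s\<close>, a path through \<open>s\<close> blocks forces a petal of depth
    at least \<open>k\<close>.\<close>
  define k where "k = nat \<lceil>s / 2\<rceil>"
  have k: "real k \<ge> s / 2" "real k - 1 < s / 2" "k \<ge> 1"
    unfolding k_def using s by linarith+
  let ?T = "{f \<in> ?A. \<exists>i\<in>?K. \<exists>n\<ge>k. depth (owner ?K) f (Some i) n}"
  have finT: "finite ?T" using finite_attachments[OF ps] by simp
  have sub: "{G \<in> F. long_path_from s G x} \<subseteq> ?g ` ?T"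
  proof
    fix G assume G: "G \<in> {G \<in> F. long_path_from s G x}"
    then have "G \<in> ?g ` ?A" using fib(1) unfolding F_def bij_betw_def by blast
    then obtain f where f: "f \<in> ?A" "G = ?g f" by blast
    have dec: "decomposition x ?K f" using f attachments_decomposition[OF fib(4)] by blast
    have comp: "component G x = ground x ?K"
      unfolding f(2) by (rule component_glue_union(1)[OF dec fib(2,3)])
    obtain p where p: "is_path G p" "hd p \<in> ground x ?K" "length p \<ge> 2"
      "s \<le> real (card {B \<in> blocks G. passes_through p B})"
      using G comp unfolding long_path_from_def by auto
    have "\<exists>i\<in>?K. \<exists>n\<ge>k. depth (owner ?K) f (Some i) n"
    proof (rule ccontr)
      assume "\<not> ?thesis"
      then have "n \<le> k - 1" if "i \<in> ?K" "depth (owner ?K) f (Some i) n" for i n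
        using that k(3) by (metis Suc_leI Suc_pred' less_Suc_eq_le not_le zero_less_one less_le_trans)
      then have "card {B \<in> blocks G. passes_through p B} \<le> 2 * (k - 1)"
        using card_blocks_path_le[OF dec fib(2,3) p(1,2,3)[unfolded f(2)], of "k - 1"] unfolding f(2) by blast
      then have "real (card {B \<in> blocks G. passes_through p B}) \<le> real (2 * (k - 1))"
        by (rule of_nat_mono)
      also have "\<dots> = 2 * (real k - 1)" using k(3) by (simp add: of_nat_diff)
      finally have "s \<le> 2 * (real k - 1)" using p(4) by simp
      then show False using k(2) by simp
    qed
    then show "G \<in> ?g ` ?T" using f by blast
  qed
  have "card {G \<in> F. long_path_from s G x} \<le> card ?T"
    using card_mono[OF finite_imageI[OF finT] sub] card_image_le[OF finT, of ?g] by linarith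
  also have "real (card ?T) \<le> 32 * exp (- (real k ^ 2) / (64 * real (card (ground x ?K)))) * real (card ?A)"
    by (rule card_tall_attachments[OF ps])
  \<comment> \<open>Halving \<open>s\<close> turns 64 into \<open>256 = 4 * 64\<close>.\<close>
  also have "\<dots> \<le> 32 * exp (- (s ^ 2) / (256 * real (card (ground x ?K)))) * real (card ?A)"
  proof (intro mult_right_mono mult_left_mono)
    have "(s / 2) ^ 2 \<le> real k ^ 2" using k(1) s by (intro power_mono) auto
    then have "(s / 2) ^ 2 / (64 * real (card (ground x ?K))) \<le> real k ^ 2 / (64 * real (card (ground x ?K)))"
      by (rule divide_right_mono) simp
    then show "exp (- (real k ^ 2) / (64 * real (card (ground x ?K)))) \<le> exp (- (s ^ 2) / (256 * real (card (ground x ?K))))"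
      by (simp add: power_divide)
  qed auto
  also have "card ?A = card F" unfolding F_def by (rule bij_betw_same_card[OF fib(1)])
  finally show ?thesis unfolding fib(5) by simp
qed

text \<open>With \<open>y = n / u - 1\<close>, the loss is \<open>n / u = 1 + y \<le> exp y\<close>,
  and it is paid for by the exponent: \<open>y \<le> (a / n) * y = a / u - a / n\<close>, as
  \<open>a \<ge> n\<close>.\<close>

lemma exp_divide_mono:
  fixes a u n :: real
  assumes "0 < u" "u \<le> n" "n \<le> a"
  shows "exp (- a / u) / u \<le> exp (- a / n) / n"
proof -
  define y where "y = n / u - 1"
  have y: "y \<ge> 0" "n = u * (1 + y)" using assms by (simp_all add: y_def field_simps)
  have n: "n > 0" using assms by linarith
  have "1 * y \<le> (a / n) * y" using assms n y by (intro mult_right_mono) (simp_all add: field_simps)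
  also have "(a / n) * y = a / u - a / n" using assms n by (simp add: y_def field_simps)
  finally have "exp y \<le> exp (a / u - a / n)" by simp
  moreover have "n / u \<le> exp y" using exp_ge_add_one_self[of y] by (simp add: y_def)
  ultimately have "n / u \<le> exp (a / u - a / n)" by linarith
  then have "n / u * exp (- (a / u)) \<le> exp (a / u - a / n) * exp (- (a / u))" by (rule mult_right_mono) simp
  also have "\<dots> = exp (- a / n)" by (simp flip: exp_add)
  finally show ?thesis using n assms by (simp add: field_simps)
qed

section \<open>From components to the whole graph\<close>

lemma block_diameter_path:
  assumes G: "is_graph G" and ne: "verts G \<noteq> {}" and s: "s > 1" "s \<le> real (block_diameter G)"
  shows "\<exists>p. is_path G p \<and> length p \<ge> 2 \<and> s \<le> real (card {B \<in> blocks G. passes_through p B})"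
proof -
  let ?c = "\<lambda>p. card {B \<in> blocks G. passes_through p B}"
  obtain v where "v \<in> verts G" using ne by blast
  then have "is_path G [v]" by (simp add: is_path_def)
  then have "{p. is_path G p} \<noteq> {}" by blast
  then have "block_diameter G \<in> ?c ` {p. is_path G p}"
    unfolding block_diameter_def using finite_paths[OF G] by (subst cSup_eq_Max) (auto intro!: Max_in)
  then obtain p where p: "is_path G p" "block_diameter G = ?c p" by blast
  have "length p \<ge> 2"
  proof (rule ccontr)
    assume "\<not> length p \<ge> 2"
    moreover have "p \<noteq> []" using p by (simp add: is_path_def)
    ultimately obtain u where u: "p = [u]" by (cases p) (auto simp: Suc_le_eq)
    have "{B \<in> blocks G. passes_through p B} \<subseteq> {({u}, {})}"
      by (auto simp: u passes_through_def path_edges_def)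
    then have "?c p \<le> card {({u}, {} :: 'a set set)}" by (intro card_mono) auto
    then show False using s p by simp
  qed
  then show ?thesis using p s by auto
qed

text \<open>The weights of a bad graph add up to at least 1, while each of the \<open>n\<close>
  vertices contributes at most the bound divided by \<open>n\<close>; summing over the vertices
  therefore costs no factor.\<close>

lemma card_large_block_diameter:
  assumes \<A>: "graph_class \<A>" "block_stable \<A>" and n: "n \<ge> 1" and t: "t \<ge> 16"
  shows "real (card {G \<in> members_on \<A> n. real (block_diameter G) \<ge> t * sqrt (real n)})
    \<le> 32 * exp (- (t ^ 2) / 256) * real (card (members_on \<A> n))"
proof -
  let ?M = "members_on \<A> n"
  define s where "s = t * sqrt (real n)"
  have "sqrt (real n) \<ge> 1" using n by simp
  then have "t * 1 \<le> s" unfolding s_def using t by (intro mult_left_mono) auto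
  then have s: "s > 1" using t by linarith
  have s2: "s ^ 2 = t ^ 2 * real n" by (simp add: s_def power_mult_distrib)
  have fin: "finite ?M" by (rule finite_members_on[OF \<A>(1)])
  have mem: "is_graph G" "verts G = {1..n}" if "G \<in> ?M" for G
    using that \<A>(1) by (auto simp: members_on_iff graph_class_def)
  have comp: "component G x \<subseteq> {1..n}" if "G \<in> ?M" "x \<in> {1..n}" for G x
    using component_subset[OF mem(1)[OF that(1)], of x] mem(2)[OF that(1)] that(2) by simp
  let ?w = "\<lambda>x G. if long_path_from s G x then 1 / real (card (component G x)) else 0"
  let ?D = "{G \<in> ?M. real (block_diameter G) \<ge> s}"
  have one: "1 \<le> (\<Sum>x\<in>{1..n}. ?w x G)" if G: "G \<in> ?D" for G
  proof -
    have GM: "G \<in> ?M" using G by simp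
    obtain p where p: "is_path G p" "length p \<ge> 2" "s \<le> real (card {B \<in> blocks G. passes_through p B})"
      using block_diameter_path[OF mem(1)[OF GM] _ s] mem(2)[OF GM] n G by auto
    let ?U = "component G (hd p)"
    have "set p \<subseteq> {1..n}" "p \<noteq> []" using p(1) mem(2)[OF GM] by (auto simp: is_path_def)
    then have hd: "hd p \<in> {1..n}" using hd_in_set by blast
    have U: "finite ?U" "card ?U > 0"
      using comp[OF GM hd] component_self[of "hd p" G] finite_subset by (auto simp: card_gt_0_iff)
    have "?w x G = 1 / real (card ?U)" if x: "x \<in> ?U" for x
    proof -
      have "component G x = ?U" by (rule component_eq[OF x])
      then show ?thesis using p component_self[of "hd p" G] unfolding long_path_from_def by auto
    qed
    then have "(\<Sum>x\<in>?U. ?w x G) = (\<Sum>x\<in>?U. 1 / real (card ?U))" by (intro sum.cong) auto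
    also have "\<dots> = 1" using U component_self[of "hd p" G] by auto
    finally have "1 = (\<Sum>x\<in>?U. ?w x G)" by simp
    also have "\<dots> \<le> (\<Sum>x\<in>{1..n}. ?w x G)"
      by (rule sum_mono2) (use comp[OF GM hd] in auto)
    finally show ?thesis .
  qed
  have fiber: "(\<Sum>G\<in>?M. ?w x G) \<le> (\<Sum>G\<in>?M. 32 * exp (- (t ^ 2) / 256) / real n)" if x: "x \<in> {1..n}" for x
  proof (rule sum_fiberwise_mono[where key = "\<lambda>G. (petals_of G x, rest G x)"])
    fix G0 assume G0: "G0 \<in> ?M"
    let ?F = "{G \<in> ?M. petals_of G x = petals_of G0 x \<and> rest G x = rest G0 x}"
    let ?u = "real (card (component G0 x))"
    have F: "{G \<in> ?M. (petals_of G x, rest G x) = (petals_of G0 x, rest G0 x)} = ?F" by simp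
    \<comment> \<open>The component of \<open>x\<close> is the ground set of its petals, so it is
      fixed by the key and the weight is constant on bad graphs of a fibre.\<close>
    have cF: "component G x = component G0 x" if "G \<in> ?F" for G
    proof -
      have "ground x (petals_of G x) = component G x"
        using bij_betw_fiber(5)[OF \<A> _ x] that by blast
      moreover have "ground x (petals_of G0 x) = component G0 x"
        using bij_betw_fiber(5)[OF \<A> G0 x] .
      ultimately show ?thesis using that by simp
    qed
    have u: "?u > 0" "?u \<le> real n"
    proof -
      have "finite (component G0 x)" using comp[OF G0 x] finite_subset by blast
      then show "?u > 0" using component_self[of x G0] by (auto simp: card_gt_0_iff)
      show "?u \<le> real n" using card_mono[OF _ comp[OF G0 x]] by simp
    qed
    have finF: "finite ?F" using fin by simp
    have "(\<Sum>G\<in>?F. ?w x G) = (\<Sum>G\<in>?F. if long_path_from s G x then 1 / ?u else 0)"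
      using cF by (intro sum.cong) auto
    also have "\<dots> = real (card {G \<in> ?F. long_path_from s G x}) / ?u"
      using finF by (simp add: sum.If_cases Int_def)
    also have "\<dots> \<le> 32 * exp (- (s ^ 2) / (256 * ?u)) * real (card ?F) / ?u"
      by (intro divide_right_mono card_long_path_fiber[OF \<A> G0 x]) (use s in auto)
    also have "\<dots> = 32 * real (card ?F) * (exp (- (s ^ 2 / 256) / ?u) / ?u)"
      by simp
    also have "\<dots> \<le> 32 * real (card ?F) * (exp (- (s ^ 2 / 256) / real n) / real n)"
    proof (intro mult_left_mono exp_divide_mono u)
      \<comment> \<open>This is where \<open>t \<ge> 16\<close> is used:
        \<open>exp_divide_mono\<close> with \<open>a = s^2 / 256\<close> requires
        \<open>n \<le> a\<close>.\<close>
      have "16 ^ 2 \<le> t ^ 2" using t by (intro power_mono) auto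
      then have "256 * real n \<le> t ^ 2 * real n" by (intro mult_right_mono) auto
      then show "real n \<le> s ^ 2 / 256" unfolding s2 by simp
    qed simp
    also have "- (s ^ 2 / 256) / real n = - (t ^ 2) / 256" using n by (simp add: s2)
    finally show "(\<Sum>G\<in>{G \<in> ?M. (petals_of G x, rest G x) = (petals_of G0 x, rest G0 x)}. ?w x G)
      \<le> (\<Sum>G\<in>{G \<in> ?M. (petals_of G x, rest G x) = (petals_of G0 x, rest G0 x)}. 32 * exp (- (t ^ 2) / 256) / real n)"
      unfolding F by (simp add: ac_simps)
  qed (rule fin)
  have "real (card ?D) = (\<Sum>G\<in>?D. 1)" by simp
  also have "\<dots> \<le> (\<Sum>G\<in>?D. \<Sum>x\<in>{1..n}. ?w x G)" by (rule sum_mono) (rule one)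
  also have "\<dots> \<le> (\<Sum>G\<in>?M. \<Sum>x\<in>{1..n}. ?w x G)"
    by (rule sum_mono2[OF fin]) (auto intro!: sum_nonneg)
  also have "\<dots> = (\<Sum>x\<in>{1..n}. \<Sum>G\<in>?M. ?w x G)" by (rule sum.swap)
  also have "\<dots> \<le> (\<Sum>x\<in>{1..n}. \<Sum>G\<in>?M. 32 * exp (- (t ^ 2) / 256) / real n)"
    by (rule sum_mono) (rule fiber)
  also have "\<dots> = 32 * exp (- (t ^ 2) / 256) * real (card ?M)" using n by simp
  finally show ?thesis by (simp only: s_def)
qed

theorem theorem26:
  fixes \<A> :: "nat graph set"
  assumes "graph_class \<A>" and "block_stable \<A>"
  shows "\<exists>c1 c2 :: real. c1 > 0 \<and> c2 > 0 \<and>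
    (\<forall>(t :: real) (n :: nat). t > 1 \<and> n \<ge> 1 \<and> members_on \<A> n \<noteq> {} \<longrightarrow>
      measure_pmf.prob (pmf_of_set (members_on \<A> n))
        {G. real (block_diameter G) \<ge> t * sqrt (real n)}
      < c1 * exp (- c2 * t\<^sup>2))"
proof (rule exI[of _ "64 :: real"], rule exI[of _ "1 / 256 :: real"], intro conjI allI impI)
  fix t :: real and n :: nat
  assume "t > 1 \<and> n \<ge> 1 \<and> members_on \<A> n \<noteq> {}"
  then have t: "t > 1" and n: "n \<ge> 1" and ne: "members_on \<A> n \<noteq> {}" by auto
  let ?M = "members_on \<A> n" and ?D = "{G. real (block_diameter G) \<ge> t * sqrt (real n)}"
  have fin: "finite ?M" by (rule finite_members_on[OF assms(1)])
  have pos: "real (card ?M) > 0" using fin ne by (simp add: card_gt_0_iff)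
  \<comment> \<open>Doubling 32 makes the inequality strict. For \<open>t < 16\<close> the
    right-hand side is at least \<open>64 / 3\<close>, hence exceeds any probability.\<close>
  show "measure_pmf.prob (pmf_of_set ?M) ?D < 64 * exp (- (1 / 256) * t\<^sup>2)"
  proof (cases "t \<ge> 16")
    case True
    have "measure_pmf.prob (pmf_of_set ?M) ?D = real (card {G \<in> ?M. real (block_diameter G) \<ge> t * sqrt (real n)}) / real (card ?M)"
      by (simp add: measure_pmf_of_set[OF ne fin] Int_def)
    also have "\<dots> \<le> 32 * exp (- (t ^ 2) / 256)"
      using card_large_block_diameter[OF assms n True] pos by (simp add: divide_le_eq)
    also have "\<dots> < 64 * exp (- (1 / 256) * t\<^sup>2)" by simp
    finally show ?thesis .
  next
    case False
    then have "t ^ 2 \<le> 16 ^ 2" using t by (intro power_mono) auto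
    then have "exp (- 1) \<le> exp (- (1 / 256) * t\<^sup>2)" by simp
    moreover have "exp (- 1) \<ge> (1 / 3 :: real)" using exp_le by (simp add: exp_minus field_simps)
    moreover have "measure_pmf.prob (pmf_of_set ?M) ?D \<le> 1" by (rule measure_pmf.prob_le_1)
    ultimately show ?thesis by linarith
  qed
qed auto

end
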